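(* Let $d\ge2$, $n\ge1$, $\varepsilon_0>0$, $\lambda=e^{\varepsilon_0}$. Then $$\inf_{\rho\in\mathfrak M_d:\,W_\rho\ \varepsilon_0\text{-LDP}}\ \sup_{\theta\in\Delta_d}R^{\mathrm{iid}}_\theta(\rho)=\frac{(d-1)^2}{n\,T^*_d(\lambda)},$$ $$\inf_{\rho\in\mathfrak M_d:\,W_\rho\ \varepsilon_0\text{-LDP}}\ \sup_{\theta}R^{\mathrm{fc}}_\theta(\rho)=\frac1n\Big[\frac{(d-1)^2}{T^*_d(\lambda)}-\frac{d-1}{d}\Big],$$ where in the second line the supremum is over $\theta\in\Delta_d$ with all $n\theta_i$ integers. Both values are attained by every convex combination of the laws $\{\rho_{s,\lambda}:s\in\mathcal S^*_{d,\lambda}\}$ (in particular by each $\rho_{s_*,\lambda}$, $s_*\in\mathcal S^*_{d,\lambda}$); conversely every exchangeable minimizer (for either problem) is such a convex combination, and the extreme exchangeable minimizers are exactly the $\rho_{s,\lambda}$, $s\in\mathcal S^*_{d,\lambda}$.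
   Context: Let $H\in\mathbb R^{d\times(d-1)}$ have orthonormal columns spanning $\{u\in\mathbb R^d:\mathbf 1^\top u=0\}$, $\gamma_i:=H^\top e_i$, $\mathcal X_d:=\{x\in\mathbb R^{d-1}:1+\gamma_i^\top x\ge0\ \forall i\}$, $\Delta_d$ the probability simplex, $h_\theta:=\sum_i\theta_i\gamma_i$, and $x(a):=H^\top(a-\mathbf 1)$ for $a\in\mathbb R^d$ with $\sum a_i=d$. An anchored law is a Borel probability measure $\rho$ on $\mathcal X_d$ with $\int x\,\rho(dx)=0$; $\mathfrak M_d$ is the set of anchored laws; $W_\rho(B\mid i):=\int_B(1+\gamma_i^\top x)\rho(dx)$; $\Sigma(\rho):=\int xx^\top\rho(dx)$. $W_\rho$ is $\varepsilon_0$-LDP if $W_\rho(B\mid j)\le e^{\varepsilon_0}W_\rho(B\mid i)$ for all Borel $B$, all $i,j$. Canonical estimator $\widehat\theta_\rho:=\mathbf 1/d+H\Sigma(\rho)^{-1}\frac1n\sum_mX_m$. $R^{\mathrm{iid}}_\theta(\rho):=\mathbb E\|\widehat\theta_\rho-\theta\|^2$ when $X_1,\dots,X_n$ are i.i.d. with law $(1+h_\theta^\top x)\rho(dx)$; $R^{\mathrm{fc}}_\theta(\rho):=\mathbb E\|\widehat\theta_\rho-\theta\|^2$ when ($n\theta_i\in\mathbb Z$) the $X_m$ are independent with exactly $n\theta_i$ from $W_\rho(\cdot\mid i)$; both are $+\infty$ if $\Sigma(\rho)$ is singular. For a permutation $\pi$ with matrix $\Pi$, $P_\pi:=H^\top\Pi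 H$; $\rho$ is exchangeable if $(P_\pi)_\#\rho=\rho$ for all $\pi$. For $1\le s\le d-1$: $\beta_s(\lambda):=\frac{d}{d+s(\lambda-1)}$, $\alpha_s(\lambda):=\lambda\beta_s(\lambda)$, $a^{(s)}_\lambda$ has $s$ coordinates $\alpha_s(\lambda)$ and $d-s$ coordinates $\beta_s(\lambda)$, $\rho_{s,\lambda}:=\frac1{d!}\sum_\pi\delta_{P_\pi x(a^{(s)}_\lambda)}$. $T_{d,\lambda}(s):=\frac{d\,s(d-s)(\lambda-1)^2}{(d+s(\lambda-1))^2}$, $T^*_d(\lambda):=\max_{1\le s\le d-1}T_{d,\lambda}(s)$, $\mathcal S^*_{d,\lambda}:=\operatorname{argmax}_sT_{d,\lambda}(s)$. *)

theory Defs
  imports "HOL-Probability.Probability" "HOL-Analysis.Analysis"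
begin

text \<open>Dimension d = CARD('d); R^(d-1) is modelled as real^'k with CARD('k) = CARD('d) - 1.
 H is a d x (d-1) matrix (rows indexed by 'd, columns by 'k).\<close>

definition valid_H :: "real^'k^'d \<Rightarrow> bool" where
  "valid_H H \<longleftrightarrow> CARD('k) = CARD('d) - 1 \<and> transpose H ** H = mat 1 \<and>
     span (columns H) = {u::real^'d. (\<Sum>i\<in>UNIV. u$i) = 0}"

definition gam :: "real^'k^'d \<Rightarrow> 'd \<Rightarrow> real^'k" where
  "gam H i = transpose H *v axis i 1"

definition Xd :: "real^'k^'d \<Rightarrow> (real^'k) set" where
  "Xd H = {x. \<forall>i. 1 + gam H i \<bullet> x \<ge> 0}"

definition prob_simplex :: "(real^'d) set" where
  "prob_simplex = {\<theta>. (\<forall>i. \<theta>$i \<ge> 0) \<and> (\<Sum>i\<in>UNIV. \<theta>$i) = 1}"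

definition hvec :: "real^'k^'d \<Rightarrow> real^'d \<Rightarrow> real^'k" where
  "hvec H \<theta> = (\<Sum>i\<in>UNIV. \<theta>$i *\<^sub>R gam H i)"

definition xa :: "real^'k^'d \<Rightarrow> real^'d \<Rightarrow> real^'k" where
  "xa H a = transpose H *v (a - (\<chi> i. 1))"

definition anchored :: "real^'k^'d \<Rightarrow> (real^'k) measure \<Rightarrow> bool" where
  "anchored H \<rho> \<longleftrightarrow> prob_space \<rho> \<and> sets \<rho> = sets borel \<and> emeasure \<rho> (Xd H) = 1 \<and>
     integrable \<rho> (\<lambda>x. x) \<and> integral\<^sup>L \<rho> (\<lambda>x. x) = 0"

definition Wch :: "real^'k^'d \<Rightarrow> (real^'k) measure \<Rightarrow> (real^'k) set \<Rightarrow> 'd \<Rightarrow> real" where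
  "Wch H \<rho> B i = (LINT x:B|\<rho>. 1 + gam H i \<bullet> x)"

definition LDP :: "real^'k^'d \<Rightarrow> real \<Rightarrow> (real^'k) measure \<Rightarrow> bool" where
  "LDP H \<epsilon> \<rho> \<longleftrightarrow> (\<forall>B\<in>sets borel. \<forall>i j. Wch H \<rho> B j \<le> exp \<epsilon> * Wch H \<rho> B i)"

definition feasible :: "real^'k^'d \<Rightarrow> real \<Rightarrow> (real^'k) measure set" where
  "feasible H \<epsilon> = {\<rho>. anchored H \<rho> \<and> LDP H \<epsilon> \<rho>}"

definition Sigma_mat :: "(real^'k) measure \<Rightarrow> real^'k^'k" where
  "Sigma_mat \<rho> = integral\<^sup>L \<rho> (\<lambda>x. \<chi> i j. x$i * x$j)"

definition est :: "real^'k^'d \<Rightarrow> (real^'k) measure \<Rightarrow> nat \<Rightarrow> (nat \<Rightarrow> real^'k) \<Rightarrow> real^'d" where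
  "est H \<rho> n X = (\<chi> i. 1 / real CARD('d)) +
      H *v (matrix_inv (Sigma_mat \<rho>) *v ((1 / real n) *\<^sub>R (\<Sum>m<n. X m)))"

definition law_theta :: "real^'k^'d \<Rightarrow> (real^'k) measure \<Rightarrow> real^'d \<Rightarrow> (real^'k) measure" where
  "law_theta H \<rho> \<theta> = density \<rho> (\<lambda>x. ennreal (1 + hvec H \<theta> \<bullet> x))"

definition law_i :: "real^'k^'d \<Rightarrow> (real^'k) measure \<Rightarrow> 'd \<Rightarrow> (real^'k) measure" where
  "law_i H \<rho> i = density \<rho> (\<lambda>x. ennreal (1 + gam H i \<bullet> x))"

definition R_iid :: "real^'k^'d \<Rightarrow> nat \<Rightarrow> (real^'k) measure \<Rightarrow> real^'d \<Rightarrow> ereal" where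
  "R_iid H n \<rho> \<theta> = (if invertible (Sigma_mat \<rho>)
     then ereal (integral\<^sup>L (PiM {..<n} (\<lambda>_. law_theta H \<rho> \<theta>)) (\<lambda>X. (norm (est H \<rho> n X - \<theta>))\<^sup>2))
     else \<infinity>)"

text \<open>Fixed-composition design: an assignment of the n users to categories,
 exactly n*theta_i users in category i (the risk does not depend on which assignment).\<close>
definition assign :: "nat \<Rightarrow> real^'d \<Rightarrow> nat \<Rightarrow> 'd" where
  "assign n \<theta> = (SOME c. \<forall>i. real (card {m\<in>{..<n}. c m = i}) = real n * \<theta>$i)"

definition R_fc :: "real^'k^'d \<Rightarrow> nat \<Rightarrow> (real^'k) measure \<Rightarrow> real^'d \<Rightarrow> ereal" where
  "R_fc H n \<rho> \<theta> = (if invertible (Sigma_mat \<rho>)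
     then ereal (integral\<^sup>L (PiM {..<n} (\<lambda>m. law_i H \<rho> (assign n \<theta> m))) (\<lambda>X. (norm (est H \<rho> n X - \<theta>))\<^sup>2))
     else \<infinity>)"

definition fc_thetas :: "nat \<Rightarrow> (real^'d) set" where
  "fc_thetas n = {\<theta>\<in>prob_simplex. \<forall>i. real n * \<theta>$i \<in> \<int>}"

definition permmat :: "('d \<Rightarrow> 'd) \<Rightarrow> real^'d^'d" where
  "permmat \<pi> = (\<chi> i j. if i = \<pi> j then 1 else 0)"

definition Pmat :: "real^'k^'d \<Rightarrow> ('d \<Rightarrow> 'd) \<Rightarrow> real^'k^'k" where
  "Pmat H \<pi> = transpose H ** permmat \<pi> ** H"

definition exchangeable :: "real^'k^'d \<Rightarrow> (real^'k) measure \<Rightarrow> bool" where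
  "exchangeable H \<rho> \<longleftrightarrow> (\<forall>\<pi>. \<pi> permutes (UNIV::'d set) \<longrightarrow> distr \<rho> borel (\<lambda>x. Pmat H \<pi> *v x) = \<rho>)"

definition beta_s :: "nat \<Rightarrow> real \<Rightarrow> nat \<Rightarrow> real" where
  "beta_s d lam s = real d / (real d + real s * (lam - 1))"

definition alpha_s :: "nat \<Rightarrow> real \<Rightarrow> nat \<Rightarrow> real" where
  "alpha_s d lam s = lam * beta_s d lam s"

definition a_s :: "real \<Rightarrow> nat \<Rightarrow> real^'d" where
  "a_s lam s = (let A = (SOME A::'d set. card A = s) in
     (\<chi> i. if i \<in> A then alpha_s CARD('d) lam s else beta_s CARD('d) lam s))"

definition rho_s :: "real^'k^'d \<Rightarrow> real \<Rightarrow> nat \<Rightarrow> (real^'k) measure" where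
  "rho_s H lam s = measure_of UNIV (sets borel)
     (\<lambda>A. \<Sum>\<pi>\<in>{p. p permutes (UNIV::'d set)}.
        ennreal (1 / fact CARD('d)) * indicator A (Pmat H \<pi> *v xa H (a_s lam s)))"

definition T_fun :: "nat \<Rightarrow> real \<Rightarrow> nat \<Rightarrow> real" where
  "T_fun d lam s = real d * real s * real (d - s) * (lam - 1)\<^sup>2 / (real d + real s * (lam - 1))\<^sup>2"

definition T_star :: "nat \<Rightarrow> real \<Rightarrow> real" where
  "T_star d lam = Max ((\<lambda>s. T_fun d lam s) ` {1..d-1})"

definition S_star :: "nat \<Rightarrow> real \<Rightarrow> nat set" where
  "S_star d lam = {s\<in>{1..d-1}. T_fun d lam s = T_star d lam}"

definition mixture :: "(nat \<Rightarrow> real) \<Rightarrow> nat set \<Rightarrow> (nat \<Rightarrow> ('a::topological_space) measure) \<Rightarrow> 'a measure" where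
  "mixture w S \<mu> = measure_of UNIV (sets borel) (\<lambda>A. \<Sum>s\<in>S. ennreal (w s) * emeasure (\<mu> s) A)"

definition mix2 :: "real \<Rightarrow> ('a::topological_space) measure \<Rightarrow> 'a measure \<Rightarrow> 'a measure" where
  "mix2 t \<mu>1 \<mu>2 = measure_of UNIV (sets borel)
     (\<lambda>A. ennreal t * emeasure \<mu>1 A + ennreal (1 - t) * emeasure \<mu>2 A)"

definition extreme_in :: "('a::topological_space) measure set \<Rightarrow> 'a measure \<Rightarrow> bool" where
  "extreme_in M \<rho> \<longleftrightarrow> \<rho> \<in> M \<and>
     (\<forall>\<mu>1\<in>M. \<forall>\<mu>2\<in>M. \<forall>t. 0 < t \<and> t < 1 \<and> \<rho> = mix2 t \<mu>1 \<mu>2 \<longrightarrow> \<mu>1 = \<rho> \<and> \<mu>2 = \<rho>)"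

definition convcomb_opt :: "real^'k^'d \<Rightarrow> real \<Rightarrow> (real^'k) measure \<Rightarrow> bool" where
  "convcomb_opt H lam \<rho> \<longleftrightarrow> (\<exists>w. (\<forall>s\<in>S_star CARD('d) lam. w s \<ge> 0) \<and>
     sum w (S_star CARD('d) lam) = 1 \<and> \<rho> = mixture w (S_star CARD('d) lam) (rho_s H lam))"

definition minimizer_iid :: "real^'k^'d \<Rightarrow> nat \<Rightarrow> real \<Rightarrow> (real^'k) measure \<Rightarrow> bool" where
  "minimizer_iid H n \<epsilon> \<rho> \<longleftrightarrow> \<rho> \<in> feasible H \<epsilon> \<and>
     (SUP \<theta>\<in>prob_simplex. R_iid H n \<rho> \<theta>) = (INF \<rho>'\<in>feasible H \<epsilon>. SUP \<theta>\<in>prob_simplex. R_iid H n \<rho>' \<theta>)"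

definition minimizer_fc :: "real^'k^'d \<Rightarrow> nat \<Rightarrow> real \<Rightarrow> (real^'k) measure \<Rightarrow> bool" where
  "minimizer_fc H n \<epsilon> \<rho> \<longleftrightarrow> \<rho> \<in> feasible H \<epsilon> \<and>
     (SUP \<theta>\<in>fc_thetas n. R_fc H n \<rho> \<theta>) = (INF \<rho>'\<in>feasible H \<epsilon>. SUP \<theta>\<in>fc_thetas n. R_fc H n \<rho>' \<theta>)"

end

theory Submission
  imports Defs
begin

text \<open>
  Write \<open>u = 1 + H x\<close> (\<open>cells\<close>) for a point \<open>x\<close>; these are the points with coordinate sum \<open>d\<close>. The
  estimator is unbiased and its risk is an affine function of
  \<open>Q(v) = \<integral> |\<Sigma>\<^sup>-\<^sup>1 x|\<^sup>2 (1 + v \<bullet> x) d\<rho>\<close> (\<open>moment\<close>). The uniform \<open>\<theta>\<close> in the i.i.d. design, and the average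
  over the vertices in the fixed-composition design, bound the worst-case risk below by
  \<open>Q(0) = tr \<Sigma>\<^sup>-\<^sup>1\<close>. Integrating \<open>|\<Sigma>\<^sup>-\<^sup>1 x - c x|\<^sup>2 \<ge> 0\<close> gives \<open>Q(0) \<ge> 2 c (d - 1) - c\<^sup>2 \<integral> |x|\<^sup>2 d\<rho>\<close>,
  to be used with \<open>c = (d - 1) / T\<^sup>*\<close>. Local differential privacy forces \<open>u\<^sub>j \<le> \<lambda> u\<^sub>i\<close> almost everywhere, and
  under this constraint \<open>|x|\<^sup>2 \<le> T\<^sup>*\<close> with equality exactly at the two-level vectors. So minimizers are
  concentrated on the orbits of the \<open>x(a\<^sup>s)\<close> with optimal \<open>s\<close>; averaging an exchangeable one over all
  permutations exhibits it as a mixture of the \<open>\<rho>\<^sub>s\<close>. Conversely, exchangeability makes \<open>\<Sigma>\<close> scalar, and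
  \<open>Q\<close> is then constant because \<open>|x|\<^sup>2 = T\<^sup>*\<close> almost everywhere.
\<close>

section \<open>Two-level vectors maximize the sum of squares\<close>

text \<open>The vector \<open>a_s\<close> with its set of large coordinates explicit instead of
  chosen, so that permutations can act on the index set.\<close>

definition level :: "real \<Rightarrow> 'd::finite set \<Rightarrow> real^'d" where
  "level lam A = (\<chi> i. if i \<in> A then alpha_s CARD('d) lam (card A) else beta_s CARD('d) lam (card A))"

section \<open>Bounds on the maximal value \<open>T_star\<close>\<close>

lemma T_fun_le_T_star: "s \<in> {1..d-1} \<Longrightarrow> T_fun d lam s \<le> T_star d lam"
  unfolding T_star_def by (rule Max_ge) auto

text \<open>Allows division by \<open>T_star\<close>, and excludes the empty and the full index set
  as maximizers, since \<open>T_fun\<close> vanishes there.\<close>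

lemma T_star_pos:
  assumes "d \<ge> 2" "lam > 1"
  shows "T_star d lam > 0"
proof -
  have "T_fun d lam 1 > 0"
    using assms unfolding T_fun_def by (intro divide_pos_pos mult_pos_pos zero_less_power) auto
  then show ?thesis
    using T_fun_le_T_star[of 1 d lam] assms by force
qed

lemma S_star_nonempty:
  assumes "d \<ge> 2"
  shows "S_star d lam \<noteq> {}"
proof -
  have "T_star d lam \<in> (\<lambda>s. T_fun d lam s) ` {1..d-1}"
    unfolding T_star_def using assms by (intro Max_in) auto
  then show ?thesis unfolding S_star_def by auto
qed

lemma finite_S_star [simp]: "finite (S_star d lam)"
  unfolding S_star_def by auto

text \<open>The right side is the squared distance from the all-ones vector to a vertex of the
  simplex of nonnegative vectors with sum \<open>d\<close>, the supremum without a privacy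
  constraint. Strictness makes the coefficient in \<open>box_gap\<close> less than 1.\<close>

lemma T_fun_less:
  assumes "s \<in> {1..d-1}" "lam > 1"
  shows "T_fun d lam s < (real d)\<^sup>2 - real d"
proof -
  have s: "1 \<le> real s" "real s \<le> real d - 1" "real (d - s) = real d - real s" "0 < real d"
    using assms(1) by (auto simp: of_nat_diff)
  define L where "L = lam - 1"
  have L: "L > 0" using assms by (simp add: L_def)
  have "real s * real (d - s) * L\<^sup>2 \<le> (real d - 1) * (real s * L)\<^sup>2"
  proof -
    have "real (d - s) \<le> real d - 1" using s by simp
    also have "\<dots> \<le> (real d - 1) * real s" using s by (simp add: mult_le_cancel_left1)
    finally have "real (d - s) * (real s * L\<^sup>2) \<le> ((real d - 1) * real s) * (real s * L\<^sup>2)"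
      using s by (intro mult_right_mono) auto
    then show ?thesis by (simp add: power2_eq_square algebra_simps)
  qed
  \<comment> \<open>Strictness comes from the positive summand \<open>d\<close> added inside the
    square.\<close>
  also have "\<dots> < (real d - 1) * (real d + real s * L)\<^sup>2"
    using s L by (intro mult_strict_left_mono power_strict_mono) auto
  finally have "real d * (real s * real (d - s) * L\<^sup>2) < real d * ((real d - 1) * (real d + real s * L)\<^sup>2)"
    using s by (intro mult_strict_left_mono) auto
  moreover have "(real d + real s * L)\<^sup>2 > 0" using s L by (intro zero_less_power add_pos_pos mult_pos_pos) auto
  ultimately have "real d * real s * real (d - s) * L\<^sup>2 / (real d + real s * L)\<^sup>2 < real d * (real d - 1)"
    by (simp add: pos_divide_less_eq mult.assoc)
  then show ?thesis
    unfolding T_fun_def L_def[symmetric] by (simp add: power2_eq_square right_diff_distrib)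
qed

lemma T_star_less:
  assumes "d \<ge> 2" "lam > 1"
  shows "T_star d lam < (real d)\<^sup>2 - real d"
proof -
  obtain s where "s \<in> S_star d lam" using S_star_nonempty[OF assms(1)] by blast
  then have "s \<in> {1..d-1}" "T_fun d lam s = T_star d lam" by (auto simp: S_star_def)
  then show ?thesis using T_fun_less[of s d lam] assms by simp
qed

lemma sum_box_vertex:
  fixes A :: "'d::finite set" and g :: "real \<Rightarrow> real"
  shows "(\<Sum>i\<in>UNIV. g (if i \<in> A then x else y)) = real (card A) * g x + (real CARD('d) - real (card A)) * g y"
proof -
  have "(\<Sum>i\<in>UNIV. g (if i \<in> A then x else y)) = (\<Sum>i\<in>UNIV. if i \<in> A then g x else g y)"
    by (rule sum.cong) auto
  also have "\<dots> = real (card A) * g x + real (card (-A)) * g y"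
    by (simp add: sum.If_cases)
  also have "real (card (-A)) = real CARD('d) - real (card A)"
    by (simp add: Compl_eq_Diff_UNIV card_Diff_subset of_nat_diff card_mono)
  finally show ?thesis .
qed

text \<open>The homogeneous form of the deviation from the bound: for \<open>\<Sum> u\<^sub>i = d\<close> it is
  \<open>\<Sum> (u\<^sub>i - 1)\<^sup>2 - T\<^sup>*\<close>. Rescaling by the minimal coordinate moves the constraint \<open>u\<^sub>j \<le> \<lambda> u\<^sub>i\<close> to the
  box \<open>[1, \<lambda>]\<^sup>d\<close>. Since the coefficient of \<open>(\<Sum> u\<^sub>i)\<^sup>2\<close> is less than 1, it is strictly convex in each
  coordinate separately, so only vertices of the box can be maximal.\<close>

definition box_gap :: "real \<Rightarrow> real^'d \<Rightarrow> real" where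
  "box_gap lam u = (\<Sum>i\<in>UNIV. (u$i)\<^sup>2) - (T_star CARD('d) lam + CARD('d)) / (real CARD('d))\<^sup>2 * (\<Sum>i\<in>UNIV. u$i)\<^sup>2"

text \<open>Scaling the vertex by \<open>beta_s\<close> gives the two-level vector of sum
  \<open>d\<close>, whose squared deviation from 1 is \<open>T_fun\<close>. The squared factor
  undoes the scaling, because \<open>box_gap\<close> is homogeneous of degree 2.\<close>

lemma box_gap_vertex:
  fixes A :: "'d::finite set" and lam :: real
  assumes "lam > 1"
  shows "box_gap lam ((\<chi> i. if i \<in> A then lam else 1) :: real^'d) =
    (T_fun CARD('d) lam (card A) - T_star CARD('d) lam) * ((real CARD('d) + real (card A) * (lam - 1)) / real CARD('d))\<^sup>2"
proof -
  define d where "d = real CARD('d)"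
  define s where "s = real (card A)"
  have d: "d > 0" "s \<ge> 0" "s \<le> d" "real (CARD('d) - card A) = d - s"
    by (auto simp: d_def s_def of_nat_diff card_mono)
  have p: "d + s * (lam - 1) \<noteq> 0" "d\<^sup>2 \<noteq> 0" using d assms
    by (smt (verit) mult_nonneg_nonneg) (use d in simp)
  have T: "T_fun CARD('d) lam (card A) * (d + s * (lam - 1))\<^sup>2 = d * s * (d - s) * (lam - 1)\<^sup>2"
    using p unfolding T_fun_def d by (simp add: d_def[symmetric] s_def[symmetric])
  have e: "(\<Sum>i\<in>UNIV. (((\<chi> i. if i \<in> A then lam else 1) :: real^'d)$i)\<^sup>2) = s * lam\<^sup>2 + (d - s)"
    using sum_box_vertex[of "\<lambda>x. x\<^sup>2" A lam 1] by (simp add: d_def s_def)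
  have e': "(\<Sum>i\<in>UNIV. ((\<chi> i. if i \<in> A then lam else 1) :: real^'d)$i) = s * lam + (d - s)"
    using sum_box_vertex[of "\<lambda>x. x" A lam 1] by (simp add: d_def s_def)
  have "box_gap lam ((\<chi> i. if i \<in> A then lam else 1) :: real^'d)
     = (d\<^sup>2 * (s * lam\<^sup>2 + (d - s)) - (T_star CARD('d) lam + d) * (d + s * (lam - 1))\<^sup>2) / d\<^sup>2"
    unfolding box_gap_def e e' using p(2) by (simp add: d_def[symmetric] field_simps)
  also have "d\<^sup>2 * (s * lam\<^sup>2 + (d - s)) - (T_star CARD('d) lam + d) * (d + s * (lam - 1))\<^sup>2
     = d * s * (d - s) * (lam - 1)\<^sup>2 - T_star CARD('d) lam * (d + s * (lam - 1))\<^sup>2"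
    by algebra
  also have "\<dots> = (T_fun CARD('d) lam (card A) - T_star CARD('d) lam) * (d + s * (lam - 1))\<^sup>2"
    using T by (simp add: algebra_simps)
  finally show ?thesis by (simp add: power_divide d_def s_def)
qed

lemma box_gap_vertex_nonpos:
  fixes A :: "'d::finite set" and lam :: real
  assumes "CARD('d) \<ge> 2" "lam > 1"
  shows "box_gap lam ((\<chi> i. if i \<in> A then lam else 1) :: real^'d) \<le> 0"
    and "box_gap lam ((\<chi> i. if i \<in> A then lam else 1) :: real^'d) = 0 \<Longrightarrow> card A \<in> S_star CARD('d) lam"
proof -
  have "real CARD('d) + real (card A) * (lam - 1) > 0"
    using assms by (intro add_pos_nonneg mult_nonneg_nonneg) auto
  then have pos: "((real CARD('d) + real (card A) * (lam - 1)) / real CARD('d))\<^sup>2 > 0"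
    by (intro zero_less_power divide_pos_pos) auto
  have c: "card A \<le> CARD('d)" by (simp add: card_mono)
  have T: "T_fun CARD('d) lam (card A) \<le> T_star CARD('d) lam"
    and eq: "T_fun CARD('d) lam (card A) = T_star CARD('d) lam \<Longrightarrow> card A \<in> S_star CARD('d) lam"
  proof -
    \<comment> \<open>The two constant vertices have \<open>T_fun\<close> equal to 0, strictly below
      the positive maximum, so they never give equality.\<close>
    consider "card A = 0" | "card A = CARD('d)" | "card A \<in> {1..CARD('d)-1}" using c
      by (cases "card A = 0"; cases "card A = CARD('d)") auto
    then have "T_fun CARD('d) lam (card A) \<le> T_star CARD('d) lam \<and>
      (T_fun CARD('d) lam (card A) = T_star CARD('d) lam \<longrightarrow> card A \<in> S_star CARD('d) lam)"
    proof cases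
      case 3
      then show ?thesis using T_fun_le_T_star[OF 3] by (simp add: S_star_def)
    qed (use T_star_pos[OF assms] in \<open>auto simp: T_fun_def\<close>)
    then show "T_fun CARD('d) lam (card A) \<le> T_star CARD('d) lam"
      "T_fun CARD('d) lam (card A) = T_star CARD('d) lam \<Longrightarrow> card A \<in> S_star CARD('d) lam" by auto
  qed
  show "box_gap lam ((\<chi> i. if i \<in> A then lam else 1) :: real^'d) \<le> 0"
    unfolding box_gap_vertex[OF assms(2)] using T pos by (intro mult_nonpos_nonneg) auto
  show "card A \<in> S_star CARD('d) lam" if "box_gap lam ((\<chi> i. if i \<in> A then lam else 1) :: real^'d) = 0"
    using that pos eq unfolding box_gap_vertex[OF assms(2)] by auto
qed

lemma box_gap_coordinate:
  fixes u :: "real^'d"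
  assumes "CARD('d) \<ge> 2" "lam > 1" "1 < u$i" "u$i < lam"
  shows "box_gap lam u < max (box_gap lam (\<chi> j. if j = i then 1 else u$j))
                             (box_gap lam (\<chi> j. if j = i then lam else u$j))"
proof -
  define K where "K = (T_star CARD('d) lam + CARD('d)) / (real CARD('d))\<^sup>2"
  have K: "K < 1" using T_star_less[OF assms(1,2)] assms(1) by (simp add: K_def)
  define A where "A = (\<Sum>j\<in>UNIV-{i}. (u$j)\<^sup>2)"
  define B where "B = (\<Sum>j\<in>UNIV-{i}. u$j)"
  define f where "f y = y\<^sup>2 + A - K * (y + B)\<^sup>2" for y
  have g: "box_gap lam (\<chi> j. if j = i then y else u$j) = f y" for y
    unfolding box_gap_def K_def[symmetric]
    by (simp add: sum.remove[of UNIV i] f_def A_def B_def)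
  have "(\<chi> j. if j = i then u$i else u$j) = u" by (simp add: vec_eq_iff)
  then have gu: "box_gap lam u = f (u$i)" using g[of "u$i"] by simp
  define y where "y = u$i"
  \<comment> \<open>The second divided difference of the quadratic \<open>f\<close> at 1,
    \<open>y\<close>, \<open>lam\<close>: only its leading coefficient \<open>1 - K\<close>
    survives.\<close>
  have "(lam - y) * (f 1 - f y) + (y - 1) * (f lam - f y) = (1 - K) * ((y - 1) * (lam - y) * (lam - 1))"
    unfolding f_def power2_eq_square by (simp add: algebra_simps)
  also have "\<dots> > 0" using K assms by (simp add: y_def)
  finally have *: "(lam - y) * (f 1 - f y) + (y - 1) * (f lam - f y) > 0" .
  have "f y < f 1 \<or> f y < f lam"
  proof (rule ccontr)
    assume "\<not> ?thesis"
    then have "(lam - y) * (f 1 - f y) \<le> 0" "(y - 1) * (f lam - f y) \<le> 0"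
      using assms by (auto simp: y_def intro!: mult_nonneg_nonpos)
    then show False using * by linarith
  qed
  then show ?thesis unfolding g gu y_def by auto
qed

text \<open>Induction on the number of coordinates strictly inside the interval. Moving one of them
  to the better endpoint strictly increases \<open>box_gap\<close>, so an interior coordinate also
  makes the inequality strict.\<close>

lemma box_gap_nonpos:
  fixes u :: "real^'d"
  assumes "CARD('d) \<ge> 2" "lam > 1" "\<And>i. 1 \<le> u$i" "\<And>i. u$i \<le> lam"
  shows "box_gap lam u \<le> 0 \<and> ((\<exists>i. 1 < u$i \<and> u$i < lam) \<longrightarrow> box_gap lam u < 0)"
  using assms(3,4)
proof (induction "card {i. 1 < u$i \<and> u$i < lam}" arbitrary: u rule: less_induct)
  case (less u)
  show ?case
  proof (cases "\<exists>i. 1 < u$i \<and> u$i < lam")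
    case False
    then have "u = (\<chi> i. if i \<in> {i. u$i = lam} then lam else 1)"
      using less.prems by (auto simp: vec_eq_iff) (metis antisym_conv1)
    then show ?thesis using box_gap_vertex_nonpos(1)[OF assms(1,2)] False by metis
  next
    case True
    then obtain i where i: "1 < u$i" "u$i < lam" by blast
    have *: "box_gap lam (\<chi> j. if j = i then y else u$j) \<le> 0" if y: "y = 1 \<or> y = lam" for y
    proof -
      let ?v = "(\<chi> j. if j = i then y else u$j)"
      have "{j. 1 < ?v$j \<and> ?v$j < lam} \<subset> {j. 1 < u$j \<and> u$j < lam}"
        using i y by auto
      then have "card {j. 1 < ?v$j \<and> ?v$j < lam} < card {j. 1 < u$j \<and> u$j < lam}"
        by (intro psubset_card_mono) auto
      from less.hyps[OF this] show ?thesis using less.prems y assms(2) by auto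
    qed
    show ?thesis using box_gap_coordinate[OF assms(1,2) i] *[of 1] *[of lam] by auto
  qed
qed

section \<open>Two-level vectors of sum \<open>d\<close> and the equality case\<close>

lemma level_ratio: "level lam (A :: 'd::finite set) = beta_s CARD('d) lam (card A) *\<^sub>R (\<chi> i. if i \<in> A then lam else 1)"
  by (simp add: level_def vec_eq_iff alpha_s_def)

lemma beta_s_pos: "d > 0 \<Longrightarrow> lam > 1 \<Longrightarrow> beta_s d lam s > 0"
  unfolding beta_s_def by (intro divide_pos_pos add_pos_nonneg) auto

lemma sum_level:
  assumes "lam > 1"
  shows "(\<Sum>i\<in>UNIV. level lam (A :: 'd::finite set) $ i) = real CARD('d)"
proof -
  have p: "real CARD('d) + real (card A) * (lam - 1) > 0"
    using assms by (intro add_pos_nonneg mult_nonneg_nonneg) auto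
  have "(\<Sum>i\<in>UNIV. level lam (A :: 'd::finite set) $ i)
      = real (card A) * alpha_s CARD('d) lam (card A) + (real CARD('d) - card A) * beta_s CARD('d) lam (card A)"
    unfolding level_def using sum_box_vertex[of "\<lambda>x. x" A] by simp
  also have "\<dots> = beta_s CARD('d) lam (card A) * (real CARD('d) + real (card A) * (lam - 1))"
    by (simp add: alpha_s_def algebra_simps)
  finally show ?thesis using p by (simp add: beta_s_def)
qed

text \<open>The ratio constraint is scale-free, so division by the smallest coordinate
  \<open>m\<close> puts the vector into the box, and homogeneity of \<open>box_gap\<close> carries
  the bound back. Equality forces a vertex with an optimal number of large coordinates.\<close>

lemma two_level_extremal:
  fixes u :: "real^'d"
  assumes d: "CARD('d) \<ge> 2" and lam: "lam > 1"
    and sum: "(\<Sum>i\<in>UNIV. u$i) = real CARD('d)" and ratio: "\<And>i j. u$j \<le> lam * u$i"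
  shows "(\<Sum>i\<in>UNIV. (u$i - 1)\<^sup>2) \<le> T_star CARD('d) lam"
    and "(\<Sum>i\<in>UNIV. (u$i - 1)\<^sup>2) = T_star CARD('d) lam \<Longrightarrow>
      \<exists>A. card A \<in> S_star CARD('d) lam \<and> u = level lam A"
proof -
  define m where "m = Min (range (\<lambda>i. u$i))"
  have m: "m \<le> u$i" for i unfolding m_def by (rule Min_le) auto
  obtain i0 where i0: "m = u$i0" using Min_in[of "range (\<lambda>i. u$i)"] unfolding m_def by fastforce
  have um: "u$j \<le> lam * m" for j using ratio[of j i0] i0 by simp
  \<comment> \<open>If \<open>m\<close> were not positive, the ratio constraint would bound every
    coordinate by \<open>lam * m\<close>, which is at most 0, contradicting the positive
    sum.\<close>
  have mpos: "m > 0"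
  proof (rule ccontr)
    assume "\<not> m > 0"
    then have "lam * m \<le> 0" using lam by (simp add: mult_nonneg_nonpos)
    then have "(\<Sum>i\<in>UNIV. u$i) \<le> 0" using um by (intro sum_nonpos) (meson order_trans)
    then show False using sum by simp
  qed
  define v where "v = (1/m) *\<^sub>R u"
  have uv: "u = m *\<^sub>R v" using mpos by (simp add: v_def)
  have v: "1 \<le> v$i" "v$i \<le> lam" for i
    using m[of i] um[of i] mpos by (auto simp: v_def field_simps)
  have d0: "real CARD('d) > 0" using d by simp
  have "box_gap lam u = (\<Sum>i\<in>UNIV. (u$i)\<^sup>2) - (T_star CARD('d) lam + CARD('d))"
    unfolding box_gap_def sum using d0 by simp
  also have "(\<Sum>i\<in>UNIV. (u$i)\<^sup>2) = (\<Sum>i\<in>UNIV. (u$i - 1)\<^sup>2) + CARD('d)"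
    using sum by (simp add: power2_diff sum.distrib sum_subtractf sum_distrib_left[symmetric])
  finally have g1: "box_gap lam u = (\<Sum>i\<in>UNIV. (u$i - 1)\<^sup>2) - T_star CARD('d) lam" by simp
  have "box_gap lam u = m\<^sup>2 * box_gap lam v"
    unfolding box_gap_def uv by (simp add: power_mult_distrib sum_distrib_left[symmetric] algebra_simps)
  then have g: "(\<Sum>i\<in>UNIV. (u$i - 1)\<^sup>2) - T_star CARD('d) lam = m\<^sup>2 * box_gap lam v"
    using g1 by simp
  note b = box_gap_nonpos[OF d lam v]
  have "m\<^sup>2 * box_gap lam v \<le> 0" using b by (intro mult_nonneg_nonpos) auto
  then show "(\<Sum>i\<in>UNIV. (u$i - 1)\<^sup>2) \<le> T_star CARD('d) lam" using g by simp
  assume "(\<Sum>i\<in>UNIV. (u$i - 1)\<^sup>2) = T_star CARD('d) lam"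
  then have b0: "box_gap lam v = 0" using g mpos by simp
  define A where "A = {i. v$i = lam}"
  have vA: "v = (\<chi> i. if i \<in> A then lam else 1)"
    using b b0 v unfolding A_def by (auto simp: vec_eq_iff) (metis antisym_conv1)
  have cA: "card A \<in> S_star CARD('d) lam"
    using box_gap_vertex_nonpos(2)[OF d lam] b0 vA by simp
  \<comment> \<open>The sum constraint determines the scale: \<open>m\<close> has to be
    \<open>beta_s\<close>.\<close>
  have "m * (real CARD('d) + real (card A) * (lam - 1)) = real CARD('d)"
    using sum sum_box_vertex[of "\<lambda>x. x" A lam 1] unfolding uv vA
    by (simp add: sum_distrib_left[symmetric] algebra_simps)
  moreover have "real CARD('d) + real (card A) * (lam - 1) > 0"
    using lam by (intro add_pos_nonneg mult_nonneg_nonneg) auto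
  ultimately have "m = beta_s CARD('d) lam (card A)"
    unfolding beta_s_def by (simp add: field_simps)
  then have "u = level lam A" unfolding level_ratio uv vA by simp
  then show "\<exists>A. card A \<in> S_star CARD('d) lam \<and> u = level lam A" using cA by blast
qed

lemma level_two_level:
  fixes A :: "'d::finite set"
  assumes lam: "lam > 1" and A: "card A \<in> S_star CARD('d) lam"
  shows "(\<Sum>i\<in>UNIV. (level lam A $ i - 1)\<^sup>2) = T_star CARD('d) lam"
    and "level lam A $ j \<le> lam * level lam A $ i"
    and "level lam A $ i > 0"
proof -
  define b where "b = beta_s CARD('d) lam (card A)"
  have b: "b > 0" unfolding b_def using lam by (intro beta_s_pos) auto
  have d0: "real CARD('d) > 0" by simp
  show "level lam A $ j \<le> lam * level lam A $ i"
    unfolding level_ratio b_def[symmetric] using b lam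
    by (auto simp: mult_le_cancel_right mult_le_cancel_left_pos mult.left_commute) (smt (verit, best) mult_less_cancel_left1)
  show "level lam A $ i > 0" unfolding level_ratio b_def[symmetric] using b lam by auto
  have "box_gap lam (level lam A) = b\<^sup>2 * box_gap lam ((\<chi> i. if i \<in> A then lam else 1) :: real^'d)"
    unfolding box_gap_def level_ratio b_def[symmetric]
    by (simp add: power_mult_distrib sum_distrib_left[symmetric] algebra_simps)
  also have "\<dots> = 0" using A unfolding box_gap_vertex[OF lam] S_star_def by simp
  finally have "(\<Sum>i\<in>UNIV. (level lam A $ i)\<^sup>2) = T_star CARD('d) lam + CARD('d)"
    unfolding box_gap_def sum_level[OF lam] using d0 by simp
  moreover have "(\<Sum>i\<in>UNIV. (level lam A $ i)\<^sup>2) = (\<Sum>i\<in>UNIV. (level lam A $ i - 1)\<^sup>2) + CARD('d)"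
    using sum_level[OF lam, of A] by (simp add: power2_diff sum.distrib sum_subtractf sum_distrib_left[symmetric])
  ultimately show "(\<Sum>i\<in>UNIV. (level lam A $ i - 1)\<^sup>2) = T_star CARD('d) lam" by simp
qed

text \<open>Neither set is the whole index set, so \<open>beta_s\<close> occurs as a coordinate in
  both vectors and is the smallest one. Equal vectors thus have equal \<open>beta_s\<close>, which
  is injective in the size of the set.\<close>

lemma level_inj_card:
  fixes A B :: "'d::finite set"
  assumes lam: "lam > 1" and A: "card A \<in> S_star CARD('d) lam" and B: "card B \<in> S_star CARD('d) lam"
    and eq: "level lam A = level lam B"
  shows "card A = card B"
proof -
  have pos: "beta_s CARD('d) lam s > 0" for s using lam by (intro beta_s_pos) auto
  obtain i j where i: "i \<notin> A" and j: "j \<notin> B"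
  proof -
    have "A \<noteq> UNIV" "B \<noteq> UNIV" using A B by (auto simp: S_star_def)
    then show ?thesis using that by blast
  qed
  have "beta_s CARD('d) lam (card A) = level lam A $ i" using i by (simp add: level_def)
  also have "\<dots> \<ge> beta_s CARD('d) lam (card B)"
    unfolding eq using pos[of "card B"] lam by (simp add: level_def alpha_s_def)
  finally have 1: "beta_s CARD('d) lam (card A) \<ge> beta_s CARD('d) lam (card B)" .
  have "beta_s CARD('d) lam (card B) = level lam B $ j" using j by (simp add: level_def)
  also have "\<dots> \<ge> beta_s CARD('d) lam (card A)"
    unfolding eq[symmetric] using pos[of "card A"] lam by (simp add: level_def alpha_s_def)
  finally have "beta_s CARD('d) lam (card A) = beta_s CARD('d) lam (card B)" using 1 by simp
  moreover have "real CARD('d) + real s * (lam - 1) > 0" for s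
    using lam by (intro add_pos_nonneg) auto
  ultimately show ?thesis using lam
    by (simp add: beta_s_def divide_eq_eq eq_divide_eq less_imp_neq[THEN not_sym] frac_eq_eq)
qed

section \<open>Cell coordinates and the permutation action\<close>

lemma gam_eq_row: "gam H i = H$i"
  unfolding gam_def by (simp add: vec_eq_iff vector_matrix_mult_def axis_def if_distrib if_distribR cong: if_cong)

lemma mv_component: "(H *v x)$i = H$i \<bullet> x"
  by (rule matrix_vector_mul_component)

text \<open>Coordinate \<open>i\<close> is the density of the channel output under category
  \<open>i\<close> with respect to the anchored law. In these coordinates positivity, privacy and
  permutations all take their simplest form.\<close>

definition cells :: "real^'k^'d \<Rightarrow> real^'k \<Rightarrow> real^'d" where
  "cells H x = (\<chi> i. 1 + H$i \<bullet> x)"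

lemma cells_nth [simp]: "cells H x $ i = 1 + H$i \<bullet> x"
  by (simp add: cells_def)

lemma Xd_eq: "Xd H = {x. \<forall>i. 0 \<le> cells H x $ i}"
  by (simp add: Xd_def gam_eq_row)

lemma hvec_eq: "hvec H \<theta> = (\<Sum>i\<in>UNIV. \<theta>$i *\<^sub>R H$i)"
  by (simp add: hvec_def gam_eq_row)

lemma hvec_inner: "hvec H \<theta> \<bullet> x = (\<Sum>i\<in>UNIV. \<theta>$i * (H$i \<bullet> x))"
  by (simp add: hvec_eq inner_sum_left)

lemma hvec_axis [simp]: "hvec H (axis i 1) = H$i"
  by (simp add: hvec_eq axis_def if_distrib if_distribR cong: if_cong)

lemma hvec_eq_transpose: "hvec H \<theta> = transpose H *v \<theta>"
  by (simp add: hvec_eq vec_eq_iff vector_matrix_mult_def mult.commute)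

lemma mix_cells:
  assumes "\<theta> \<in> prob_simplex"
  shows "1 + hvec H \<theta> \<bullet> x = (\<Sum>i\<in>UNIV. \<theta>$i * cells H x $ i)"
  using assms by (simp add: hvec_inner prob_simplex_def distrib_left sum.distrib)

lemma uniform_in_simplex: "(\<chi> i. 1 / real CARD('d)) \<in> (prob_simplex :: (real^'d) set)"
  by (simp add: prob_simplex_def)

lemma axis_in_simplex: "axis i 1 \<in> (prob_simplex :: (real^'d) set)"
  by (simp add: prob_simplex_def axis_def)

locale centred_frame =
  fixes H :: "real^'k^'d"
  assumes valid: "valid_H H"
begin

lemma tH_H: "transpose H *v (H *v x) = x"
  using valid by (metis valid_H_def matrix_vector_mul_assoc matrix_vector_mul_lid)

lemma norm_H: "norm (H *v x) = norm x"
proof -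
  have "(H *v x) \<bullet> (H *v x) = (transpose H *v (H *v x)) \<bullet> x"
    by (simp add: dot_lmul_matrix)
  then show ?thesis unfolding tH_H norm_eq .
qed

lemma sum_H: "(\<Sum>i\<in>UNIV. (H *v x)$i) = 0"
  using matrix_vector_mult_in_columnspace[of H x] valid by (simp add: valid_H_def)

lemma sum_rows: "(\<Sum>i\<in>UNIV. H$i) = 0"
proof -
  have "(\<Sum>i\<in>UNIV. H$i) \<bullet> x = 0" for x
    using sum_H[of x] by (simp add: inner_sum_left mv_component)
  then show ?thesis by (metis inner_eq_zero_iff)
qed

text \<open>\<open>H ** transpose H\<close> acts as the identity on the column space of
  \<open>H\<close>, which consists of the vectors of sum zero.\<close>

lemma H_tH:
  assumes "(\<Sum>i\<in>UNIV. u$i) = 0"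
  shows "H *v (transpose H *v u) = u"
proof -
  have "subspace (range ((*v) H))"
    by (intro linear_subspace_image) auto
  moreover have "columns H \<subseteq> range ((*v) H)"
    by (auto simp: columns_def column_def image_def) (metis matrix_vector_mult_basis column_def)
  ultimately have "span (columns H) \<subseteq> range ((*v) H)"
    by (intro span_minimal)
  moreover have "u \<in> span (columns H)" using assms valid by (simp add: valid_H_def)
  ultimately obtain y where "u = H *v y" by blast
  then show ?thesis by (metis tH_H)
qed

lemma tH_one: "transpose H *v (\<chi> i. c) = 0"
proof -
  have "transpose H *v (\<chi> i. c) = c *\<^sub>R (\<Sum>i\<in>UNIV. H$i)"
    unfolding hvec_eq_transpose[symmetric] hvec_eq by (simp add: scaleR_sum_right)
  then show ?thesis using sum_rows by simp
qed

text \<open>The identity behind unbiasedness: \<open>H\<close> applied to an unbiased estimate of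
  \<open>hvec\<close>, shifted by the uniform vector, estimates \<theta> without bias.\<close>

lemma H_hvec:
  assumes "\<theta> \<in> prob_simplex"
  shows "H *v hvec H \<theta> = \<theta> - (\<chi> i. 1 / real CARD('d))"
proof -
  have "hvec H \<theta> = transpose H *v (\<theta> - (\<chi> i. 1 / real CARD('d)))"
    unfolding matrix_vector_mult_diff_distrib tH_one by (simp add: hvec_eq_transpose)
  then show ?thesis using assms by (simp only:) (rule H_tH, simp add: sum_subtractf prob_simplex_def)
qed

lemma hvec_uniform: "hvec H (\<chi> i. c) = 0"
  using tH_one by (simp add: hvec_eq_transpose)

text \<open>A diagonal entry of the orthogonal projection \<open>H ** transpose H\<close> onto the
  vectors of sum zero.\<close>

lemma norm_row: "(norm (H$i))\<^sup>2 = 1 - 1 / real CARD('d)"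
proof -
  have "H$i \<bullet> H$i = (H *v hvec H (axis i 1)) $ i" by (simp add: mv_component)
  also have "\<dots> = 1 - 1 / real CARD('d)"
    unfolding H_hvec[OF axis_in_simplex] by (simp add: axis_def)
  finally show ?thesis by (simp add: power2_norm_eq_inner)
qed

lemma sum_cells: "(\<Sum>i\<in>UNIV. cells H x $ i) = real CARD('d)"
  using sum_H[of x] by (simp add: sum.distrib mv_component)

text \<open>Since \<open>H\<close> is an isometry, the squared norm becomes the squared deviation
  from 1 that the extremal inequality bounds.\<close>

lemma norm_sq_cells: "(norm x)\<^sup>2 = (\<Sum>i\<in>UNIV. (cells H x $ i - 1)\<^sup>2)"
proof -
  have "(norm x)\<^sup>2 = (norm (H *v x))\<^sup>2" by (simp add: norm_H)
  also have "\<dots> = (\<Sum>i\<in>UNIV. (H$i \<bullet> x)\<^sup>2)"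
    unfolding power2_norm_eq_inner inner_vec_def[of "H *v x"] mv_component by (simp add: power2_eq_square)
  finally show ?thesis by simp
qed

lemma cells_xa:
  assumes "(\<Sum>i\<in>UNIV. a$i) = real CARD('d)"
  shows "cells H (xa H a) = a"
proof -
  have "H *v xa H a = a - (\<chi> i. 1)"
    unfolding xa_def by (rule H_tH) (simp add: sum_subtractf assms)
  then have "H$i \<bullet> xa H a = a$i - 1" for i by (metis mv_component vector_minus_component vec_lambda_beta)
  then show ?thesis by (simp add: vec_eq_iff)
qed

lemma xa_cells: "xa H (cells H x) = x"
proof -
  have "cells H x - (\<chi> i. 1) = H *v x" by (simp add: vec_eq_iff mv_component)
  then show ?thesis unfolding xa_def by (metis tH_H)
qed

section \<open>Permutations in cell coordinates\<close>

lemma permmat_nth: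
  assumes "\<pi> permutes (UNIV :: 'a::finite set)"
  shows "(permmat \<pi> *v a) $ i = a $ (inv \<pi> i)"
proof -
  have "i = \<pi> j \<longleftrightarrow> j = inv \<pi> i" for j
    using assms by (metis permutes_inverses)
  then show ?thesis
    by (simp add: permmat_def matrix_vector_mult_def if_distrib if_distribR cong: if_cong)
qed

lemma Pmat_eq: "Pmat H \<pi> *v x = transpose H *v (permmat \<pi> *v (H *v x))"
  unfolding Pmat_def by (simp only: matrix_vector_mul_assoc matrix_mul_assoc)

text \<open>A permuted vector of sum zero still has sum zero, so the projection hidden in
  \<open>Pmat\<close> changes nothing and only the index permutation remains.\<close>

lemma cells_Pmat:
  assumes "\<pi> permutes (UNIV :: 'd set)"
  shows "cells H (Pmat H \<pi> *v x) $ i = cells H x $ inv \<pi> i"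
proof -
  have b: "inv \<pi> permutes (UNIV :: 'd set)" using assms by (rule permutes_inv)
  have "(\<Sum>i\<in>UNIV. (permmat \<pi> *v (H *v x)) $ i) = (\<Sum>i\<in>UNIV. (H *v x) $ i)"
    unfolding permmat_nth[OF assms] using sum.permute[OF b, of "\<lambda>i. (H *v x) $ i"] by (simp add: o_def)
  then have "H *v (Pmat H \<pi> *v x) = permmat \<pi> *v (H *v x)"
    unfolding Pmat_eq by (intro H_tH) (simp only: sum_H)
  then have "(H *v (Pmat H \<pi> *v x)) $ i = (H *v x) $ inv \<pi> i"
    by (simp only: permmat_nth[OF assms])
  then show ?thesis by (simp add: mv_component)
qed

lemma cells_inj: "cells H x = cells H y \<longleftrightarrow> x = y"
  by (metis xa_cells)

lemma Pmat_compose: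
  assumes "\<pi> permutes (UNIV :: 'd set)" "\<sigma> permutes (UNIV :: 'd set)"
  shows "Pmat H \<pi> *v (Pmat H \<sigma> *v x) = Pmat H (\<pi> \<circ> \<sigma>) *v x"
proof -
  have "(\<pi> \<circ> \<sigma>) permutes (UNIV :: 'd set)" using assms by (intro permutes_compose)
  moreover have "inv (\<pi> \<circ> \<sigma>) = inv \<sigma> \<circ> inv \<pi>"
    using assms by (intro o_inv_distrib) (auto dest: permutes_bij)
  ultimately show ?thesis
    unfolding cells_inj[symmetric] vec_eq_iff using assms by (simp add: cells_Pmat del: cells_nth)
qed

lemma Pmat_xa_level:
  assumes "\<pi> permutes (UNIV :: 'd set)" "lam > 1"
  shows "Pmat H \<pi> *v xa H (level lam A) = xa H (level lam (\<pi> ` A))"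
proof -
  have c: "card (\<pi> ` A) = card A"
    using assms(1) by (intro card_image) (meson permutes_inj_on)
  have m: "inv \<pi> i \<in> A \<longleftrightarrow> i \<in> \<pi> ` A" for i
    using assms(1) by (metis image_iff permutes_inverses)
  show ?thesis
    unfolding cells_inj[symmetric] vec_eq_iff cells_Pmat[OF assms(1)] cells_xa[OF sum_level[OF assms(2)]]
    by (simp add: level_def c m)
qed

end

text \<open>Glue a bijection between the sets with one between their complements, which also have
  equal size.\<close>

lemma exists_permutation_image:
  fixes A B :: "'a::finite set"
  assumes "card A = card B"
  obtains \<pi> where "\<pi> permutes UNIV" "\<pi> ` A = B"
proof -
  obtain f where f: "bij_betw f A B" using assms by (meson finite_same_card_bij finite)
  have "card (- A) = card (- B)" using assms by (simp add: Compl_eq_Diff_UNIV card_Diff_subset)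
  then obtain g where g: "bij_betw g (-A) (-B)" by (meson finite_same_card_bij finite)
  define \<pi> where "\<pi> x = (if x \<in> A then f x else g x)" for x
  have "bij_betw \<pi> (A \<union> -A) (B \<union> -B)"
    unfolding \<pi>_def using f g by (intro bij_betw_disjoint_Un) auto
  then have "\<pi> permutes UNIV" by (intro bij_imp_permutes) auto
  moreover have "\<pi> ` A = B" using f by (auto simp: \<pi>_def bij_betw_def)
  ultimately show ?thesis using that by blast
qed

section \<open>Mixtures of orbit laws\<close>

text \<open>\<open>rho_s\<close>, \<open>mixture\<close> and \<open>mix2\<close> are all given by
  set functions that are finite nonnegative combinations of Borel measures. This provides the
  countable additivity that \<open>measure_of\<close> requires, once for all three.\<close>

lemma emeasure_combination:
  fixes M :: "'i \<Rightarrow> 'a::topological_space measure" and c :: "'i \<Rightarrow> ennreal"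
  assumes eq: "\<And>A. A \<in> sets borel \<Longrightarrow> \<mu> A = (\<Sum>i\<in>I. c i * emeasure (M i) A)"
    and M: "\<And>i. i \<in> I \<Longrightarrow> sets (M i) = sets borel"
    and B: "B \<in> sets borel"
  shows "emeasure (measure_of UNIV (sets borel) \<mu>) B = \<mu> B"
proof (rule emeasure_measure_of_sigma)
  show "sigma_algebra UNIV (sets (borel :: 'a measure))"
    by (metis sets.sigma_algebra_axioms space_borel)
  show "positive (sets borel) \<mu>" by (simp add: positive_def eq)
  show "countably_additive (sets borel) \<mu>"
  proof (rule countably_additiveI)
    fix A :: "nat \<Rightarrow> 'a set"
    assume A: "range A \<subseteq> sets borel" "disjoint_family A" "\<Union> (range A) \<in> sets borel"
    have "(\<Sum>n. \<mu> (A n)) = (\<Sum>n. \<Sum>i\<in>I. c i * emeasure (M i) (A n))"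
      using A(1) by (intro suminf_cong eq) auto
    also have "\<dots> = (\<Sum>i\<in>I. \<Sum>n. c i * emeasure (M i) (A n))"
      by (rule suminf_sum) simp
    also have "\<dots> = (\<Sum>i\<in>I. c i * emeasure (M i) (\<Union> (range A)))"
      using A M by (intro sum.cong refl) (simp add: suminf_emeasure)
    finally show "(\<Sum>n. \<mu> (A n)) = \<mu> (\<Union> (range A))" using A(3) by (simp add: eq)
  qed
qed fact

lemma
  fixes \<mu> :: "'a::topological_space set \<Rightarrow> ennreal"
  shows sets_measure_of_borel: "sets (measure_of UNIV (sets borel) \<mu>) = sets borel"
    and space_measure_of_borel: "space (measure_of UNIV (sets borel) \<mu>) = UNIV"
proof -
  show "sets (measure_of UNIV (sets borel) \<mu>) = sets borel"
    using sets.sigma_sets_eq[of borel] sets.space_closed[of borel]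
    by (simp add: sets_measure_of_conv)
  show "space (measure_of UNIV (sets borel) \<mu>) = UNIV"
    by (simp add: space_measure_of_conv)
qed

lemma sets_rho_s [simp, measurable_cong]: "sets (rho_s H lam s) = sets borel"
  and sets_mixture [simp, measurable_cong]: "sets (mixture w S \<mu>) = sets borel"
  and sets_mix2 [simp, measurable_cong]: "sets (mix2 t \<mu>1 \<mu>2) = sets borel"
  by (simp_all add: rho_s_def mixture_def mix2_def sets_measure_of_borel)

lemma space_rho_s [simp]: "space (rho_s H lam s) = UNIV"
  and space_mixture [simp]: "space (mixture w S \<mu>) = UNIV"
  by (simp_all add: rho_s_def mixture_def space_measure_of_borel)

lemma emeasure_rho_s:
  fixes H :: "real^'k^'d"
  assumes "B \<in> sets borel"
  shows "emeasure (rho_s H lam s) B = (\<Sum>\<pi>\<in>{p. p permutes (UNIV::'d set)}.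
        ennreal (1 / fact CARD('d)) * indicator B (Pmat H \<pi> *v xa H (a_s lam s)))"
  unfolding rho_s_def using assms
  by (intro emeasure_combination[where M = "\<lambda>\<pi>. return borel (Pmat H \<pi> *v xa H (a_s lam s))"
        and c = "\<lambda>_. ennreal (1 / fact CARD('d))" and I = "{p. p permutes (UNIV::'d set)}"])
     (auto simp: emeasure_return)

lemma emeasure_mixture:
  assumes "B \<in> sets borel" "\<And>s. s \<in> S \<Longrightarrow> sets (\<mu> s) = sets borel"
  shows "emeasure (mixture w S \<mu>) B = (\<Sum>s\<in>S. ennreal (w s) * emeasure (\<mu> s) B)"
  unfolding mixture_def
  by (intro emeasure_combination[where M = \<mu> and c = "\<lambda>s. ennreal (w s)" and I = S] assms refl)

lemma emeasure_mix2:
  assumes "B \<in> sets borel" "sets \<mu>1 = sets borel" "sets \<mu>2 = sets borel"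
  shows "emeasure (mix2 t \<mu>1 \<mu>2) B = ennreal t * emeasure \<mu>1 B + ennreal (1 - t) * emeasure \<mu>2 B"
  unfolding mix2_def using assms
  by (intro emeasure_combination[where M = "\<lambda>b. if b then \<mu>1 else \<mu>2"
        and c = "\<lambda>b. ennreal (if b then t else 1 - t)" and I = UNIV]) (auto simp: UNIV_bool add.commute)

lemma finite_permutations_UNIV [simp]: "finite {p. p permutes (UNIV :: 'd::finite set)}"
  by (rule finite_permutations) simp

lemma permutation_weights: "of_nat (card {p. p permutes (UNIV :: 'd::finite set)}) * ennreal (1 / fact CARD('d)) = 1"
proof -
  have "of_nat (card {p. p permutes (UNIV :: 'd set)}) * ennreal (1 / fact CARD('d))
      = ennreal (real (fact CARD('d)) * (1 / fact CARD('d)))"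
    by (simp add: card_permutations ennreal_of_nat_eq_real_of_nat ennreal_mult[symmetric] del: of_nat_fact)
  then show ?thesis by simp
qed

section \<open>Orbits of optimal two-level points and their mixtures\<close>

locale optimal_frame = centred_frame H for H :: "real^'k^'d" +
  fixes lam :: real
  assumes lam: "lam > 1" and d2: "CARD('d) \<ge> 2"
begin

text \<open>For \<open>s\<close> at most \<open>d\<close> this is the permutation orbit of
  \<open>xa H (a_s lam s)\<close>, indexed by the sets of large coordinates and therefore free of
  the choice in \<open>a_s\<close>.\<close>

definition orbit :: "nat \<Rightarrow> (real^'k) set" where
  "orbit s = (\<lambda>A. xa H (level lam A)) ` {A :: 'd set. card A = s}"

definition optima :: "(real^'k) set" where
  "optima = (\<Union>s\<in>S_star CARD('d) lam. orbit s)"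

lemma finite_orbit [simp]: "finite (orbit s)"
  by (simp add: orbit_def)

lemma orbit_borel [simp, measurable]: "orbit s \<in> sets borel"
  by (intro borel_closed finite_imp_closed) simp

lemma optima_borel [simp, measurable]: "optima \<in> sets borel"
  unfolding optima_def by (intro borel_closed finite_imp_closed) simp

lemma orbit_disjoint:
  assumes "s \<in> S_star CARD('d) lam" "t \<in> S_star CARD('d) lam" "x \<in> orbit s" "x \<in> orbit t"
  shows "s = t"
proof -
  obtain A B :: "'d set" where AB: "card A = s" "card B = t" "x = xa H (level lam A)" "x = xa H (level lam B)"
    using assms(3,4) by (auto simp: orbit_def)
  then have "level lam A = level lam B"
    using cells_xa[OF sum_level[OF lam, of A]] cells_xa[OF sum_level[OF lam, of B]] by simp
  then show ?thesis using level_inj_card[OF lam, of A B] assms AB by simp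
qed

lemma S_star_le: "s \<in> S_star CARD('d) lam \<Longrightarrow> s \<le> CARD('d)"
  by (auto simp: S_star_def)

lemma a_s_level:
  assumes "s \<le> CARD('d)"
  obtains A :: "'d set" where "card A = s" "a_s lam s = level lam A"
proof -
  obtain A :: "'d set" where "card A = s"
    using obtain_subset_with_card_n[of s "UNIV :: 'd set"] assms by auto
  then have *: "card (SOME A :: 'd set. card A = s) = s" by (rule someI)
  have "a_s lam s = level lam (SOME A :: 'd set. card A = s)"
    unfolding a_s_def level_def Let_def * ..
  with * show ?thesis by (rule that)
qed

lemma orbit_Pmat: "\<pi> permutes UNIV \<Longrightarrow> x \<in> orbit s \<Longrightarrow> Pmat H \<pi> *v x \<in> orbit s"
  using lam by (auto simp: orbit_def Pmat_xa_level intro!: imageI card_image permutes_inj_on)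

text \<open>Every orbit point is a permuted copy of the base point, and composing the summation
  index on the right with a fixed permutation leaves the sum unchanged. So symmetrizing a point mass
  anywhere on the orbit gives \<open>rho_s\<close>.\<close>

lemma orbit_average:
  assumes "s \<le> CARD('d)" "x \<in> orbit s" "B \<in> sets borel"
  shows "(\<Sum>\<sigma>\<in>{p. p permutes (UNIV::'d set)}. ennreal (1 / fact CARD('d)) * indicator B (Pmat H \<sigma> *v x))
      = emeasure (rho_s H lam s) B"
proof -
  obtain A0 :: "'d set" where A0: "card A0 = s" "a_s lam s = level lam A0"
    using a_s_level[OF assms(1)] .
  obtain A :: "'d set" where A: "card A = s" "x = xa H (level lam A)"
    using assms(2) by (auto simp: orbit_def)
  obtain \<pi> where \<pi>: "\<pi> permutes UNIV" "\<pi> ` A0 = A"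
    using exists_permutation_image[of A0 A] A0(1) A(1) by metis
  have x: "x = Pmat H \<pi> *v xa H (a_s lam s)"
    using Pmat_xa_level[OF \<pi>(1) lam, of A0] \<pi>(2) A0(2) A(2) by simp
  have "(\<Sum>\<sigma>\<in>{p. p permutes (UNIV::'d set)}. ennreal (1 / fact CARD('d)) * indicator B (Pmat H \<sigma> *v x))
    = (\<Sum>\<sigma>\<in>{p. p permutes (UNIV::'d set)}. ennreal (1 / fact CARD('d)) * indicator B (Pmat H (\<sigma> \<circ> \<pi>) *v xa H (a_s lam s)))"
    unfolding x using \<pi>(1) by (intro sum.cong) (simp_all add: Pmat_compose)
  also have "\<dots> = (\<Sum>\<sigma>\<in>{p. p permutes (UNIV::'d set)}. ennreal (1 / fact CARD('d)) * indicator B (Pmat H \<sigma> *v xa H (a_s lam s)))"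
    by (rule sum_permutations_compose_right[OF \<pi>(1), symmetric])
  finally show ?thesis unfolding emeasure_rho_s[OF assms(3)] .
qed

lemma xa_a_s_orbit: "s \<le> CARD('d) \<Longrightarrow> xa H (a_s lam s) \<in> orbit s"
  using a_s_level[of s] by (metis (mono_tags, lifting) imageI mem_Collect_eq orbit_def)

lemma prob_space_rho_s: "prob_space (rho_s H lam s)"
  by (rule prob_spaceI) (simp add: emeasure_rho_s permutation_weights)

text \<open>Lets the weights of a mixture be read off as the masses of the orbits.\<close>

lemma rho_s_orbit:
  assumes "s \<in> S_star CARD('d) lam" "t \<in> S_star CARD('d) lam"
  shows "emeasure (rho_s H lam s) (orbit t) = (if s = t then 1 else 0)"
proof -
  have s: "s \<le> CARD('d)" using assms(1) by (rule S_star_le)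
  have "indicator (orbit t) (Pmat H \<pi> *v xa H (a_s lam s)) = (if s = t then 1 else 0 :: ennreal)"
    if "\<pi> permutes UNIV" for \<pi>
    using orbit_Pmat[OF that xa_a_s_orbit[OF s]] orbit_disjoint[OF assms] by (auto simp: indicator_def)
  then show ?thesis by (simp add: emeasure_rho_s permutation_weights)
qed

lemma rho_s_optima:
  assumes "s \<in> S_star CARD('d) lam"
  shows "emeasure (rho_s H lam s) optima = 1"
proof -
  have s: "s \<le> CARD('d)" using assms(1) by (rule S_star_le)
  have "indicator optima (Pmat H \<pi> *v xa H (a_s lam s)) = (1 :: ennreal)"
    if "\<pi> permutes UNIV" for \<pi>
    using orbit_Pmat[OF that xa_a_s_orbit[OF s]] assms by (auto simp: indicator_def optima_def)
  then show ?thesis by (simp add: emeasure_rho_s permutation_weights)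
qed

lemma Pmat_measurable [measurable]: "(\<lambda>x. Pmat H \<pi> *v x) \<in> borel_measurable borel"
  by (intro borel_measurable_continuous_onI continuous_intros)

lemma rho_s_invariant:
  assumes "s \<in> S_star CARD('d) lam" "\<pi> permutes (UNIV :: 'd set)" "B \<in> sets borel"
  shows "emeasure (rho_s H lam s) ((\<lambda>x. Pmat H \<pi> *v x) -` B) = emeasure (rho_s H lam s) B"
proof -
  have m: "(\<lambda>x. Pmat H \<pi> *v x) -` B \<in> sets borel"
    using measurable_sets[OF Pmat_measurable assms(3)] by simp
  let ?x = "xa H (a_s lam s)"
  have "emeasure (rho_s H lam s) ((\<lambda>x. Pmat H \<pi> *v x) -` B) =
     (\<Sum>\<sigma>\<in>{p. p permutes (UNIV::'d set)}. ennreal (1 / fact CARD('d)) * indicator B (Pmat H (\<pi> \<circ> \<sigma>) *v ?x))"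
    unfolding emeasure_rho_s[OF m] using assms(2)
    by (intro sum.cong) (simp_all add: indicator_vimage[symmetric] indicator_def Pmat_compose)
  also have "\<dots> = (\<Sum>\<sigma>\<in>{p. p permutes (UNIV::'d set)}. ennreal (1 / fact CARD('d)) * indicator B (Pmat H \<sigma> *v ?x))"
    by (rule setum_permutations_compose_left[OF assms(2), symmetric])
  finally show ?thesis unfolding emeasure_rho_s[OF assms(3)] .
qed

text \<open>A description of the convex combinations that mentions no weights; symmetry and support
  are what the risk computation uses and what the analysis of minimizers delivers.\<close>

definition optimal_law :: "(real^'k) measure \<Rightarrow> bool" where
  "optimal_law \<rho> \<longleftrightarrow> prob_space \<rho> \<and> sets \<rho> = sets borel \<and> exchangeable H \<rho> \<and> (AE x in \<rho>. x \<in> optima)"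

lemma convcomb_opt_imp_optimal_law:
  assumes "convcomb_opt H lam \<rho>"
  shows "optimal_law \<rho>"
proof -
  obtain w where w: "\<And>s. s \<in> S_star CARD('d) lam \<Longrightarrow> w s \<ge> 0" "sum w (S_star CARD('d) lam) = 1"
    and \<rho>: "\<rho> = mixture w (S_star CARD('d) lam) (rho_s H lam)"
    using assms by (auto simp: convcomb_opt_def)
  have em: "emeasure \<rho> B = (\<Sum>s\<in>S_star CARD('d) lam. ennreal (w s) * emeasure (rho_s H lam s) B)"
    if "B \<in> sets borel" for B unfolding \<rho> using that by (rule emeasure_mixture) simp
  have sets [simp, measurable_cong]: "sets \<rho> = sets borel" and space [simp]: "space \<rho> = UNIV" by (simp_all add: \<rho>)
  have w1: "(\<Sum>s\<in>S_star CARD('d) lam. ennreal (w s)) = 1"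
    using w by (simp add: sum_ennreal)
  have opt: "emeasure \<rho> optima = 1" by (simp add: em rho_s_optima w1)
  interpret prob_space \<rho>
  proof (rule prob_spaceI)
    have "emeasure (rho_s H lam s) UNIV = 1" for s
      using prob_space.emeasure_space_1[OF prob_space_rho_s] by simp
    then show "emeasure \<rho> (space \<rho>) = 1" by (simp add: em w1)
  qed
  have "AE x in \<rho>. x \<in> optima"
    using opt by (intro AE_prob_1) (simp add: measure_def)
  moreover have "exchangeable H \<rho>"
    unfolding exchangeable_def
  proof (intro allI impI measure_eqI)
    fix \<pi> :: "'d \<Rightarrow> 'd" and B assume \<pi>: "\<pi> permutes UNIV" and B: "B \<in> sets (distr \<rho> borel ((*v) (Pmat H \<pi>)))"
    then have B': "B \<in> sets borel" by simp
    have m: "(\<lambda>x. Pmat H \<pi> *v x) -` B \<in> sets borel"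
      using measurable_sets[OF Pmat_measurable B'] by simp
    have "emeasure (distr \<rho> borel ((*v) (Pmat H \<pi>))) B = emeasure \<rho> ((*v) (Pmat H \<pi>) -` B)"
      using B' by (subst emeasure_distr) (simp_all)
    also have "\<dots> = emeasure \<rho> B" using rho_s_invariant[OF _ \<pi> B'] by (simp add: em m B')
    finally show "emeasure (distr \<rho> borel ((*v) (Pmat H \<pi>))) B = emeasure \<rho> B" .
  qed simp
  ultimately show ?thesis unfolding optimal_law_def using prob_space_axioms by simp
qed

text \<open>An exchangeable law equals its average over all permutations. On each orbit the averaged
  point mass is the corresponding \<open>rho_s\<close>, so the weight of \<open>rho_s\<close> is the
  mass of that orbit.\<close>

lemma optimal_law_imp_convcomb_opt:
  assumes "optimal_law \<rho>"
  shows "convcomb_opt H lam \<rho>"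
proof -
  from assms interpret prob_space \<rho> by (simp add: optimal_law_def)
  have [simp, measurable_cong]: "sets \<rho> = sets borel" and ex: "exchangeable H \<rho>" and ae: "AE x in \<rho>. x \<in> optima"
    using assms by (auto simp: optimal_law_def)
  have [simp]: "space \<rho> = UNIV" using sets_eq_imp_space_eq[of \<rho> borel] by simp
  let ?S = "S_star CARD('d) lam"
  define w where "w s = measure \<rho> (orbit s)" for s
  have w: "ennreal (w s) = emeasure \<rho> (orbit s)" for s by (simp add: w_def emeasure_eq_measure)
  have em: "emeasure \<rho> B = (\<Sum>s\<in>?S. ennreal (w s) * emeasure (rho_s H lam s) B)"
    if B[measurable]: "B \<in> sets borel" for B
  proof -
    have inv: "(\<integral>\<^sup>+x. indicator B (Pmat H \<pi> *v x) \<partial>\<rho>) = emeasure \<rho> B" if "\<pi> permutes UNIV" for \<pi>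
    proof -
      have "emeasure \<rho> B = (\<integral>\<^sup>+x. indicator B x \<partial>distr \<rho> borel (\<lambda>x. Pmat H \<pi> *v x))"
        using ex that by (simp add: exchangeable_def)
      then show ?thesis by (subst (asm) nn_integral_distr) simp_all
    qed
    have "emeasure \<rho> B = (\<Sum>\<pi>\<in>{p. p permutes (UNIV::'d set)}. ennreal (1 / fact CARD('d)) * emeasure \<rho> B)"
      by (simp add: permutation_weights mult.assoc[symmetric])
    also have "\<dots> = (\<Sum>\<pi>\<in>{p. p permutes (UNIV::'d set)}. ennreal (1 / fact CARD('d)) * (\<integral>\<^sup>+x. indicator B (Pmat H \<pi> *v x) \<partial>\<rho>))"
      by (intro sum.cong) (simp_all add: inv)
    also have "\<dots> = (\<Sum>\<pi>\<in>{p. p permutes (UNIV::'d set)}. \<integral>\<^sup>+x. ennreal (1 / fact CARD('d)) * indicator B (Pmat H \<pi> *v x) \<partial>\<rho>)"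
      by (intro sum.cong refl nn_integral_cmult[symmetric]) measurable
    also have "\<dots> = (\<integral>\<^sup>+x. (\<Sum>\<pi>\<in>{p. p permutes (UNIV::'d set)}. ennreal (1 / fact CARD('d)) * indicator B (Pmat H \<pi> *v x)) \<partial>\<rho>)"
      by (intro nn_integral_sum[symmetric]) measurable
    \<comment> \<open>Almost every point lies in exactly one optimal orbit, and there
      \<open>orbit_average\<close> evaluates the symmetrized indicator.\<close>
    also have "\<dots> = (\<integral>\<^sup>+x. (\<Sum>s\<in>?S. emeasure (rho_s H lam s) B * indicator (orbit s) x) \<partial>\<rho>)"
    proof (rule nn_integral_cong_AE, use ae in eventually_elim)
      fix x assume "x \<in> optima"
      then obtain t where t: "t \<in> ?S" "x \<in> orbit t" by (auto simp: optima_def)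
      have "(\<Sum>s\<in>?S. emeasure (rho_s H lam s) B * indicator (orbit s) x) = emeasure (rho_s H lam t) B"
      proof -
        have "emeasure (rho_s H lam s) B * indicator (orbit s) x = (if s = t then emeasure (rho_s H lam t) B else 0)"
          if "s \<in> ?S" for s using orbit_disjoint[OF that t(1) _ t(2)] t(2) by (cases "s = t") (auto simp: indicator_def)
        then have "(\<Sum>s\<in>?S. emeasure (rho_s H lam s) B * indicator (orbit s) x)
            = (\<Sum>s\<in>?S. if s = t then emeasure (rho_s H lam t) B else 0)"
          by (rule sum.cong[OF refl])
        then show ?thesis using t(1) by simp
      qed
      then show "(\<Sum>\<pi>\<in>{p. p permutes (UNIV::'d set)}. ennreal (1 / fact CARD('d)) * indicator B (Pmat H \<pi> *v x))
          = (\<Sum>s\<in>?S. emeasure (rho_s H lam s) B * indicator (orbit s) x)"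
        using orbit_average[OF S_star_le[OF t(1)] t(2) B] by (rule trans[OF _ sym, rotated])
    qed
    also have "\<dots> = (\<Sum>s\<in>?S. ennreal (w s) * emeasure (rho_s H lam s) B)"
      by (subst nn_integral_sum, simp, simp add: nn_integral_cmult_indicator w del: sum_mult_indicator, simp add: mult.commute)
    finally show ?thesis .
  qed
  have "sum w ?S = 1"
  proof -
    have "sum w ?S = measure \<rho> optima"
      unfolding w_def optima_def
      using orbit_disjoint by (intro finite_measure_finite_Union[symmetric]) (auto simp: disjoint_family_on_def)
    then show ?thesis using ae by (simp add: prob_eq_1)
  qed
  moreover have "\<rho> = mixture w ?S (rho_s H lam)"
    by (rule measure_eqI) (simp_all add: em emeasure_mixture)
  ultimately show ?thesis unfolding convcomb_opt_def by (intro exI[of _ w]) (simp add: w_def)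
qed

lemma convcomb_opt_iff: "convcomb_opt H lam \<rho> \<longleftrightarrow> optimal_law \<rho>"
  using convcomb_opt_imp_optimal_law optimal_law_imp_convcomb_opt by blast

lemma convcomb_opt_rho_s:
  assumes "s \<in> S_star CARD('d) lam"
  shows "convcomb_opt H lam (rho_s H lam s)"
proof -
  have "rho_s H lam s = mixture (\<lambda>t. if t = s then 1 else 0) (S_star CARD('d) lam) (rho_s H lam)"
    by (rule measure_eqI) (simp_all add: emeasure_mixture if_distrib if_distribR assms cong: if_cong)
  then show ?thesis using assms unfolding convcomb_opt_def
    by (intro exI[of _ "\<lambda>t. if t = s then 1 else 0"]) auto
qed

text \<open>A component of weight strictly between 0 and 1 can be split off from the renormalized
  rest, so an extreme mixture is a single \<open>rho_s\<close>. Conversely, if \<open>rho_s\<close>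
  is a proper mixture of two such laws, both vanish on all other optimal orbits, which leaves them
  weight on \<open>rho_s\<close> only.\<close>

lemma extreme_convcomb:
  "{\<rho>. extreme_in {\<rho>'. convcomb_opt H lam \<rho>'} \<rho>} = rho_s H lam ` S_star CARD('d) lam"
proof (intro equalityI subsetI)
  let ?S = "S_star CARD('d) lam"
  fix \<rho> assume "\<rho> \<in> {\<rho>. extreme_in {\<rho>'. convcomb_opt H lam \<rho>'} \<rho>}"
  then have cc: "convcomb_opt H lam \<rho>"
    and ext: "\<And>\<mu>1 \<mu>2 t. convcomb_opt H lam \<mu>1 \<Longrightarrow> convcomb_opt H lam \<mu>2 \<Longrightarrow> 0 < t \<Longrightarrow> t < 1
       \<Longrightarrow> \<rho> = mix2 t \<mu>1 \<mu>2 \<Longrightarrow> \<mu>1 = \<rho>"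
    by (auto simp: extreme_in_def)
  obtain w where w: "\<And>s. s \<in> ?S \<Longrightarrow> w s \<ge> 0" "sum w ?S = 1"
    and \<rho>: "\<rho> = mixture w ?S (rho_s H lam)"
    using cc by (auto simp: convcomb_opt_def)
  obtain s where s: "s \<in> ?S" "w s > 0"
    using w by (metis sum.neutral less_eq_real_def zero_neq_one)
  have rest: "w s + sum w (?S - {s}) = 1"
    using w(2) s(1) by (simp add: sum.remove)
  have rest0: "sum w (?S - {s}) \<ge> 0" using w(1) by (intro sum_nonneg) auto
  have "\<rho> = rho_s H lam s"
  proof (cases "w s = 1")
    case True
    then have "sum w (?S - {s}) = 0" using rest by simp
    then have 0: "w t = 0" if "t \<in> ?S" "t \<noteq> s" for t
      using that w(1) sum_nonneg_eq_0_iff[of "?S - {s}" w] by auto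
    show ?thesis
    proof (rule measure_eqI)
      fix B assume "B \<in> sets \<rho>"
      then have B: "B \<in> sets borel" by (simp add: \<rho>)
      have "(\<Sum>t\<in>?S - {s}. ennreal (w t) * emeasure (rho_s H lam t) B) = 0"
        using 0 by (intro sum.neutral) auto
      then show "emeasure \<rho> B = emeasure (rho_s H lam s) B"
        unfolding \<rho> using s B True by (simp add: emeasure_mixture sum.remove[of ?S s])
    qed (simp add: \<rho>)
  next
    case False
    then have w1: "w s < 1" using rest rest0 by simp
    \<comment> \<open>The weights of the other components, renormalized to sum 1.\<close>
    define v where "v t = (if t = s then 0 else w t / (1 - w s))" for t
    have v: "\<And>t. t \<in> ?S \<Longrightarrow> v t \<ge> 0" using w(1) w1 by (simp add: v_def)
    have "sum v ?S = sum v (?S - {s})" using s by (simp add: sum.remove[of ?S s] v_def)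
    also have "\<dots> = sum w (?S - {s}) / (1 - w s)"
      unfolding sum_divide_distrib by (intro sum.cong) (auto simp: v_def)
    also have "\<dots> = 1" using rest w1 by (simp add: field_simps)
    finally have v1: "sum v ?S = 1" .
    let ?\<mu> = "mixture v ?S (rho_s H lam)"
    have \<mu>: "convcomb_opt H lam ?\<mu>" using v v1 unfolding convcomb_opt_def by blast
    have "\<rho> = mix2 (w s) (rho_s H lam s) ?\<mu>"
    proof (rule measure_eqI)
      fix B assume "B \<in> sets \<rho>"
      then have B: "B \<in> sets borel" by (simp add: \<rho>)
      have "ennreal (1 - w s) * emeasure ?\<mu> B = (\<Sum>t\<in>?S. ennreal (1 - w s) * (ennreal (v t) * emeasure (rho_s H lam t) B))"
        using B by (simp add: emeasure_mixture sum_distrib_left)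
      also have "\<dots> = (\<Sum>t\<in>?S - {s}. ennreal (w t) * emeasure (rho_s H lam t) B)"
      proof -
        have "ennreal (1 - w s) * (ennreal (v t) * y) = ennreal (w t) * y" if "t \<in> ?S - {s}" for t y
        proof -
          have "ennreal (1 - w s) * ennreal (v t) = ennreal (w t)"
            using that w1 w(1) v by (simp add: ennreal_mult[symmetric] v_def)
          then show ?thesis by (metis mult.assoc)
        qed
        then show ?thesis using s by (simp add: sum.remove[of ?S s] v_def)
      qed
      finally show "emeasure \<rho> B = emeasure (mix2 (w s) (rho_s H lam s) ?\<mu>) B"
        unfolding \<rho> using s B by (simp add: emeasure_mix2 emeasure_mixture[of B ?S "rho_s H lam" w] sum.remove[of ?S s])
    qed (simp add: \<rho>)
    from ext[OF convcomb_opt_rho_s[OF s(1)] \<mu> s(2) w1 this] show ?thesis by simp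
  qed
  then show "\<rho> \<in> rho_s H lam ` ?S" using s by blast
next
  let ?S = "S_star CARD('d) lam"
  fix \<rho> assume "\<rho> \<in> rho_s H lam ` ?S"
  then obtain s where s: "s \<in> ?S" and \<rho>: "\<rho> = rho_s H lam s" by blast
  \<comment> \<open>Weights are masses of orbits, so without mass on the other orbits all weight
    sits at \<open>s\<close>.\<close>
  have conc: "\<mu> = \<rho>" if cc: "convcomb_opt H lam \<mu>" and z: "\<And>t. t \<in> ?S - {s} \<Longrightarrow> emeasure \<mu> (orbit t) = 0" for \<mu>
  proof -
    obtain w where w: "\<And>s. s \<in> ?S \<Longrightarrow> w s \<ge> 0" "sum w ?S = 1"
      and \<mu>: "\<mu> = mixture w ?S (rho_s H lam)"
      using cc by (auto simp: convcomb_opt_def)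
    have "emeasure \<mu> (orbit t) = ennreal (w t)" if "t \<in> ?S" for t
      unfolding \<mu> using that by (simp add: emeasure_mixture rho_s_orbit if_distrib cong: if_cong)
    then have w0: "w t = 0" if "t \<in> ?S - {s}" for t
      using z[OF that] w(1)[of t] that by (metis DiffD1 ennreal_eq_0_iff order_antisym)
    have "w s = 1" using w(2) s w0 by (simp add: sum.remove[of ?S s])
    show ?thesis
    proof (rule measure_eqI)
      fix B assume "B \<in> sets \<mu>"
      then have B: "B \<in> sets borel" by (simp add: \<mu>)
      have "(\<Sum>t\<in>?S - {s}. ennreal (w t) * emeasure (rho_s H lam t) B) = 0"
        using w0 by (intro sum.neutral) auto
      then show "emeasure \<mu> B = emeasure \<rho> B"
        unfolding \<mu> \<rho> using s B \<open>w s = 1\<close> by (simp add: emeasure_mixture sum.remove[of ?S s])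
    qed (simp add: \<rho> \<mu>)
  qed
  have "\<mu>1 = \<rho> \<and> \<mu>2 = \<rho>"
    if "convcomb_opt H lam \<mu>1" "convcomb_opt H lam \<mu>2" "0 < t" "t < 1" "\<rho> = mix2 t \<mu>1 \<mu>2" for \<mu>1 \<mu>2 t
  proof -
    have "sets \<mu>1 = sets borel" "sets \<mu>2 = sets borel"
      using that(1,2) by (auto simp: convcomb_opt_iff optimal_law_def)
    then have "ennreal t * emeasure \<mu>1 (orbit r) + ennreal (1 - t) * emeasure \<mu>2 (orbit r) = 0" if "r \<in> ?S - {s}" for r
      using that \<open>\<rho> = mix2 t \<mu>1 \<mu>2\<close> rho_s_orbit[OF s, of r] unfolding \<rho>
      by (metis DiffD1 DiffD2 emeasure_mix2 insertI1 orbit_borel)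
    then have "emeasure \<mu>1 (orbit r) = 0" "emeasure \<mu>2 (orbit r) = 0" if "r \<in> ?S - {s}" for r
      using that \<open>0 < t\<close> \<open>t < 1\<close> by (auto simp: add_eq_0_iff_both_eq_0)
    then show ?thesis using conc that(1,2) by blast
  qed
  then show "\<rho> \<in> {\<rho>. extreme_in {\<rho>'. convcomb_opt H lam \<rho>'} \<rho>}"
    using convcomb_opt_rho_s[OF s] by (auto simp: extreme_in_def \<rho>)
qed

end

section \<open>The risk of the canonical estimator\<close>

text \<open>Expand the square: by independence the mixed terms factor into means, which are zero,
  and only the diagonal survives.\<close>

lemma (in product_prob_space) centred_sum_sq_real:
  fixes f :: "'i \<Rightarrow> 'a \<Rightarrow> real"
  assumes fin: "finite I"
    and int: "\<And>i. i \<in> I \<Longrightarrow> integrable (M i) (f i)"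
    and int2: "\<And>i. i \<in> I \<Longrightarrow> integrable (M i) (\<lambda>x. (f i x)\<^sup>2)"
    and centred: "\<And>i. i \<in> I \<Longrightarrow> integral\<^sup>L (M i) (f i) = 0"
  shows "integrable (PiM I M) (\<lambda>X. (\<Sum>i\<in>I. f i (X i))\<^sup>2)"
    and "(\<integral>X. (\<Sum>i\<in>I. f i (X i))\<^sup>2 \<partial>PiM I M) = (\<Sum>i\<in>I. \<integral>x. (f i x)\<^sup>2 \<partial>M i)"
proof -
  have pair: "integrable (PiM I M) (\<lambda>X. f k (X k) * f l (X l))"
    "(\<integral>X. f k (X k) * f l (X l) \<partial>PiM I M) = (if k = l then \<integral>x. (f k x)\<^sup>2 \<partial>M k else 0)"
    if kl: "k \<in> I" "l \<in> I" for k l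
  proof -
    \<comment> \<open>Factors equal to 1 except at \<open>k\<close> and \<open>l\<close>, so that
      one product formula over the whole of \<open>I\<close> covers both \<open>k = l\<close> and
      distinct indices.\<close>
    define g where "g = (\<lambda>i x. (if i = k then f i x else 1) * (if i = l then f i x else 1))"
    have gi: "integrable (M i) (g i)" if "i \<in> I" for i
      using int[OF that] int2[OF that] unfolding g_def
      by (cases "i = k"; cases "i = l") (simp_all add: power2_eq_square)
    have eq: "(\<Prod>i\<in>I. g i (X i)) = f k (X k) * f l (X l)" for X
      unfolding g_def prod.distrib using kl fin by (simp add: prod.delta)
    show "integrable (PiM I M) (\<lambda>X. f k (X k) * f l (X l))"
      using product_integrable_prod[OF fin gi] by (simp add: eq)
    have int_g: "(\<integral>X. f k (X k) * f l (X l) \<partial>PiM I M) = (\<Prod>i\<in>I. integral\<^sup>L (M i) (g i))"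
      using product_integral_prod[OF fin gi] by (simp add: eq)
    show "(\<integral>X. f k (X k) * f l (X l) \<partial>PiM I M) = (if k = l then \<integral>x. (f k x)\<^sup>2 \<partial>M k else 0)"
    proof (cases "k = l")
      case True
      have "(\<Prod>i\<in>I. integral\<^sup>L (M i) (g i)) = (\<Prod>i\<in>I. if i = k then \<integral>x. (f k x)\<^sup>2 \<partial>M k else 1)"
        using True by (intro prod.cong) (auto simp: g_def power2_eq_square M.prob_space)
      then show ?thesis using True kl fin int_g by (simp add: prod.delta)
    next
      case False
      then have "integral\<^sup>L (M k) (g k) = 0" using centred[OF kl(1)] by (simp add: g_def)
      then have "(\<Prod>i\<in>I. integral\<^sup>L (M i) (g i)) = 0" using kl fin by (intro prod_zero) auto
      then show ?thesis using False int_g by simp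
    qed
  qed
  have sq: "(\<Sum>i\<in>I. f i (X i))\<^sup>2 = (\<Sum>k\<in>I. \<Sum>l\<in>I. f k (X k) * f l (X l))" for X
    by (simp add: power2_eq_square sum_product)
  show "integrable (PiM I M) (\<lambda>X. (\<Sum>i\<in>I. f i (X i))\<^sup>2)"
    unfolding sq by (intro Bochner_Integration.integrable_sum pair)
  show "(\<integral>X. (\<Sum>i\<in>I. f i (X i))\<^sup>2 \<partial>PiM I M) = (\<Sum>i\<in>I. \<integral>x. (f i x)\<^sup>2 \<partial>M i)"
    unfolding sq using fin by (simp add: pair Bochner_Integration.integral_sum Bochner_Integration.integrable_sum)
qed

text \<open>The scalar identity, applied to each coordinate and summed over an orthonormal
  basis.\<close>

lemma (in product_prob_space) centred_sum_norm_sq: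
  fixes Y :: "'i \<Rightarrow> 'a \<Rightarrow> 'b::euclidean_space"
  assumes fin: "finite I"
    and int: "\<And>i. i \<in> I \<Longrightarrow> integrable (M i) (Y i)"
    and int2: "\<And>i. i \<in> I \<Longrightarrow> integrable (M i) (\<lambda>x. (norm (Y i x))\<^sup>2)"
    and centred: "\<And>i. i \<in> I \<Longrightarrow> integral\<^sup>L (M i) (Y i) = 0"
  shows "(\<integral>X. (norm (\<Sum>i\<in>I. Y i (X i)))\<^sup>2 \<partial>PiM I M) = (\<Sum>i\<in>I. \<integral>x. (norm (Y i x))\<^sup>2 \<partial>M i)"
proof -
  have norm_sq: "(norm y)\<^sup>2 = (\<Sum>b\<in>Basis. (y \<bullet> b)\<^sup>2)" for y :: 'b
    unfolding power2_norm_eq_inner using euclidean_inner[of y y] by (simp add: power2_eq_square)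
  have i1: "integrable (M i) (\<lambda>x. Y i x \<bullet> b)" if "i \<in> I" for i b
    using int[OF that] by simp
  have i2: "integrable (M i) (\<lambda>x. (Y i x \<bullet> b)\<^sup>2)" if "i \<in> I" "b \<in> Basis" for i b
  proof (rule Bochner_Integration.integrable_bound[OF int2[OF that(1)]])
    show "(\<lambda>x. (Y i x \<bullet> b)\<^sup>2) \<in> borel_measurable (M i)"
      using borel_measurable_integrable[OF i1[OF that(1)]] by measurable
    show "AE x in M i. norm ((Y i x \<bullet> b)\<^sup>2) \<le> norm ((norm (Y i x))\<^sup>2)"
      using that(2) Basis_le_norm by (intro AE_I2) (simp add: power2_le_iff_abs_le)
  qed
  have c: "(\<integral>x. Y i x \<bullet> b \<partial>M i) = 0" if "i \<in> I" for i b
    using centred[OF that] int[OF that] by simp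
  have "(\<integral>X. (norm (\<Sum>i\<in>I. Y i (X i)))\<^sup>2 \<partial>PiM I M) = (\<integral>X. (\<Sum>b\<in>Basis. (\<Sum>i\<in>I. Y i (X i) \<bullet> b)\<^sup>2) \<partial>PiM I M)"
    by (simp add: norm_sq inner_sum_left)
  also have "\<dots> = (\<Sum>b\<in>Basis. \<integral>X. (\<Sum>i\<in>I. Y i (X i) \<bullet> b)\<^sup>2 \<partial>PiM I M)"
    using centred_sum_sq_real(1)[OF fin i1 i2 c] by (intro Bochner_Integration.integral_sum) auto
  also have "\<dots> = (\<Sum>b\<in>Basis. \<Sum>i\<in>I. \<integral>x. (Y i x \<bullet> b)\<^sup>2 \<partial>M i)"
    using centred_sum_sq_real(2)[OF fin i1 i2 c] by (intro sum.cong) auto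
  also have "\<dots> = (\<Sum>i\<in>I. \<Sum>b\<in>Basis. \<integral>x. (Y i x \<bullet> b)\<^sup>2 \<partial>M i)"
    by (rule sum.swap)
  also have "\<dots> = (\<Sum>i\<in>I. \<integral>x. (norm (Y i x))\<^sup>2 \<partial>M i)"
    unfolding norm_sq using i2 by (intro sum.cong refl Bochner_Integration.integral_sum[symmetric]) auto
  finally show ?thesis .
qed

locale anchored_law = centred_frame H + prob_space \<rho>
  for H :: "real^'k^'d" and \<rho> :: "(real^'k) measure" +
  assumes sets_rho [simp, measurable_cong]: "sets \<rho> = sets borel"
    and AE_Xd: "AE x in \<rho>. x \<in> Xd H"
    and mean_zero: "(\<integral>x. x \<partial>\<rho>) = 0"
begin

lemma space_rho [simp]: "space \<rho> = UNIV"
  using sets_eq_imp_space_eq[OF sets_rho] by simp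

lemma prob_UNIV: "prob UNIV = 1"
  using prob_space by simp

text \<open>\<open>cells\<close> maps \<open>Xd\<close> into the simplex of nonnegative vectors of
  sum \<open>d\<close>, and \<open>norm_sq_cells\<close> translates boundedness back.\<close>

lemma Xd_bounded: "bounded (Xd H)"
proof (rule boundedI)
  fix x assume "x \<in> Xd H"
  then have pos: "\<And>i. 0 \<le> cells H x $ i" by (simp add: Xd_eq)
  have "cells H x $ i \<le> real CARD('d)" for i
    using member_le_sum[of i UNIV "\<lambda>i. cells H x $ i"] pos sum_cells[of x] by simp
  then have "\<bar>cells H x $ i - 1\<bar> \<le> real CARD('d) + 1" for i using pos[of i] by (smt (verit))
  then have "(cells H x $ i - 1)\<^sup>2 \<le> (real CARD('d) + 1)\<^sup>2" for i by (intro power2_le_iff_abs_le[THEN iffD2]) auto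
  then have "(norm x)\<^sup>2 \<le> (\<Sum>i\<in>(UNIV :: 'd set). (real CARD('d) + 1)\<^sup>2)"
    unfolding norm_sq_cells by (intro sum_mono)
  then show "norm x \<le> sqrt (\<Sum>i\<in>(UNIV :: 'd set). (real CARD('d) + 1)\<^sup>2)"
    by (intro real_le_rsqrt)
qed

text \<open>A continuous function is bounded on the compact closure of \<open>Xd\<close>, and
  \<open>Xd\<close> carries almost all the mass.\<close>

lemma integrable_cont:
  fixes f :: "real^'k \<Rightarrow> 'b::euclidean_space"
  assumes f: "continuous_on UNIV f"
  shows "integrable \<rho> f"
proof -
  have "compact (closure (Xd H))" using Xd_bounded by simp
  then have "compact (f ` closure (Xd H))" by (meson compact_continuous_image continuous_on_subset f subset_UNIV)
  then obtain B where B: "\<And>y. y \<in> f ` closure (Xd H) \<Longrightarrow> norm y \<le> B"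
    using compact_imp_bounded bounded_iff by metis
  show ?thesis
  proof (rule integrable_const_bound)
    show "AE x in \<rho>. norm (f x) \<le> B"
      using AE_Xd by eventually_elim (use B closure_subset in blast)
    show "f \<in> borel_measurable \<rho>"
      using borel_measurable_continuous_onI[OF f] by simp
  qed
qed

lemma Sigma_nth: "Sigma_mat \<rho> $ i $ j = (\<integral>x. x$i * x$j \<partial>\<rho>)"
proof -
  have int: "integrable \<rho> (\<lambda>x. (\<chi> i j. x$i * x$j) :: real^'k^'k)"
    by (intro integrable_cont continuous_intros)
  have "bounded_linear (\<lambda>A :: real^'k^'k. A$i$j)"
    by (intro bounded_linear_compose[OF bounded_linear_vec_nth bounded_linear_vec_nth])
  from integral_bounded_linear[OF this int] show ?thesis by (simp add: Sigma_mat_def)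
qed

lemma second_moment_mult: "(\<integral>x. (v \<bullet> x) *\<^sub>R x \<partial>\<rho>) = Sigma_mat \<rho> *v v"
proof -
  have int: "integrable \<rho> (\<lambda>x. (v \<bullet> x) *\<^sub>R x)" by (intro integrable_cont continuous_intros)
  have "(\<integral>x. (v \<bullet> x) *\<^sub>R x \<partial>\<rho>) $ i = (Sigma_mat \<rho> *v v) $ i" for i
  proof -
    have "(\<integral>x. (v \<bullet> x) *\<^sub>R x \<partial>\<rho>) $ i = (\<integral>x. ((v \<bullet> x) *\<^sub>R x) $ i \<partial>\<rho>)"
      using integral_bounded_linear[OF bounded_linear_vec_nth int] by simp
    also have "\<dots> = (\<integral>x. (\<Sum>j\<in>UNIV. v$j * (x$i * x$j)) \<partial>\<rho>)"
      by (simp add: inner_vec_def sum_distrib_left mult_ac)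
    also have "\<dots> = (\<Sum>j\<in>UNIV. v$j * (\<integral>x. x$i * x$j \<partial>\<rho>))"
      by (subst Bochner_Integration.integral_sum) (auto intro!: integrable_cont continuous_intros)
    finally show ?thesis by (simp add: matrix_vector_mult_def Sigma_nth mult.commute)
  qed
  then show ?thesis by (simp add: vec_eq_iff)
qed

lemma inner_moment: "(\<integral>x. (A *v x) \<bullet> x \<partial>\<rho>) = trace (A ** Sigma_mat \<rho>)"
proof -
  have "(\<integral>x. (A *v x) \<bullet> x \<partial>\<rho>) = (\<integral>x. (\<Sum>i\<in>UNIV. \<Sum>j\<in>UNIV. A$i$j * (x$j * x$i)) \<partial>\<rho>)"
    by (simp add: inner_vec_def matrix_vector_mult_def sum_distrib_left mult_ac)
  also have "\<dots> = (\<Sum>i\<in>UNIV. \<Sum>j\<in>UNIV. A$i$j * (\<integral>x. x$j * x$i \<partial>\<rho>))"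
    by (subst Bochner_Integration.integral_sum, (intro integrable_cont continuous_intros)[],
        intro sum.cong refl, subst Bochner_Integration.integral_sum)
       (auto intro!: integrable_cont continuous_intros)
  finally show ?thesis by (simp add: trace_def matrix_matrix_mult_def Sigma_nth)
qed

text \<open>Covers \<open>law_theta\<close>, with \<open>hvec\<close> as the tilt, and
  \<open>law_i\<close>, with a row of \<open>H\<close>, so that one risk computation serves both
  designs.\<close>

definition tilt :: "real^'k \<Rightarrow> (real^'k) measure" where
  "tilt v = density \<rho> (\<lambda>x. ennreal (1 + v \<bullet> x))"

text \<open>Guarantees that \<open>ennreal\<close> does not cut off negative values of the
  density.\<close>

definition admissible :: "real^'k \<Rightarrow> bool" where
  "admissible v \<longleftrightarrow> (AE x in \<rho>. 0 \<le> 1 + v \<bullet> x)"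

lemma admissible_hvec: "\<theta> \<in> prob_simplex \<Longrightarrow> admissible (hvec H \<theta>)"
  unfolding admissible_def using AE_Xd
  by eventually_elim (auto simp: mix_cells Xd_eq prob_simplex_def simp del: cells_nth intro!: sum_nonneg)

lemma admissible_row: "admissible (H$i)"
  using admissible_hvec[OF axis_in_simplex, of i] by simp

lemma integral_tilt:
  fixes f :: "real^'k \<Rightarrow> 'b::euclidean_space"
  assumes "admissible v" "continuous_on UNIV f"
  shows "integrable (tilt v) f" "integral\<^sup>L (tilt v) f = (\<integral>x. (1 + v \<bullet> x) *\<^sub>R f x \<partial>\<rho>)"
proof -
  have [measurable]: "f \<in> borel_measurable borel"
    by (rule borel_measurable_continuous_onI) fact
  show "integrable (tilt v) f"
    unfolding tilt_def using assms
    by (subst integrable_density) (auto simp: admissible_def intro!: integrable_cont continuous_intros)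
  show "integral\<^sup>L (tilt v) f = (\<integral>x. (1 + v \<bullet> x) *\<^sub>R f x \<partial>\<rho>)"
    unfolding tilt_def using assms by (subst integral_density) (auto simp: admissible_def)
qed

lemma inner_mean_zero: "(\<integral>x. v \<bullet> x \<partial>\<rho>) = 0"
  using integral_inner_right[of v \<rho> "\<lambda>x. x"] mean_zero
  by (simp add: integrable_cont continuous_on_id)

text \<open>The linear part of the density integrates to 0 because the law is centred.\<close>

lemma prob_space_tilt:
  assumes "admissible v"
  shows "prob_space (tilt v)"
proof (rule prob_spaceI)
  have i: "integrable \<rho> (\<lambda>x. 1 + v \<bullet> x)" by (intro integrable_cont continuous_intros)
  have "emeasure (tilt v) (space (tilt v)) = (\<integral>\<^sup>+x. ennreal (1 + v \<bullet> x) \<partial>\<rho>)"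
    by (simp add: tilt_def emeasure_density)
  also have "\<dots> = ennreal (\<integral>x. 1 + v \<bullet> x \<partial>\<rho>)"
    using assms i by (intro nn_integral_eq_integral) (auto simp: admissible_def)
  also have "(\<integral>x. 1 + v \<bullet> x \<partial>\<rho>) = 1"
    by (subst Bochner_Integration.integral_add) (auto simp: inner_mean_zero prob_UNIV intro!: integrable_cont continuous_intros)
  finally show "emeasure (tilt v) (space (tilt v)) = 1" by simp
qed

definition prec :: "real^'k^'k" where
  "prec = matrix_inv (Sigma_mat \<rho>)"

definition moment :: "real^'k \<Rightarrow> real" where
  "moment v = (\<integral>x. (1 + v \<bullet> x) * (norm (prec *v x))\<^sup>2 \<partial>\<rho>)"

lemma prec_mult:
  assumes "invertible (Sigma_mat \<rho>)"
  shows "prec ** Sigma_mat \<rho> = mat 1"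
  using someI_ex[of "\<lambda>A. Sigma_mat \<rho> ** A = mat 1 \<and> A ** Sigma_mat \<rho> = mat 1"] assms
  unfolding prec_def matrix_inv_def invertible_def by blast

text \<open>Against the density, the constant part contributes the zero mean and the linear part
  contributes \<open>Sigma_mat \<rho> *v v\<close>; the inverse matrix returns
  \<open>v\<close>.\<close>

lemma tilt_mean:
  assumes inv: "invertible (Sigma_mat \<rho>)" and v: "admissible v"
  shows "(\<integral>x. prec *v x - v \<partial>tilt v) = 0"
proof -
  have i: "integrable \<rho> (\<lambda>x. (1 + v \<bullet> x) *\<^sub>R x)" "integrable \<rho> (\<lambda>x. (v \<bullet> x) *\<^sub>R x)" "integrable \<rho> (\<lambda>x. x)"
    by (intro integrable_cont continuous_intros)+
  interpret T: prob_space "tilt v" using v by (rule prob_space_tilt)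
  have "(\<integral>x. x \<partial>tilt v) = (\<integral>x. (1 + v \<bullet> x) *\<^sub>R x \<partial>\<rho>)"
    using v by (intro integral_tilt continuous_intros)
  also have "\<dots> = Sigma_mat \<rho> *v v"
    using i by (simp add: scaleR_add_left mean_zero second_moment_mult)
  finally have m: "(\<integral>x. x \<partial>tilt v) = Sigma_mat \<rho> *v v" .
  have "(\<integral>x. prec *v x - v \<partial>tilt v) = (\<integral>x. prec *v x \<partial>tilt v) - v"
    using v by (subst Bochner_Integration.integral_diff) (auto simp: T.prob_space intro!: integral_tilt continuous_intros)
  also have "(\<integral>x. prec *v x \<partial>tilt v) = prec *v (\<integral>x. x \<partial>tilt v)"
    using v by (intro integral_bounded_linear matrix_vector_mul_bounded_linear integral_tilt continuous_intros)
  finally show ?thesis using prec_mult[OF inv] by (simp add: m matrix_vector_mul_assoc)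
qed

lemma tilt_variance:
  assumes inv: "invertible (Sigma_mat \<rho>)" and v: "admissible v"
  shows "(\<integral>x. (norm (prec *v x - v))\<^sup>2 \<partial>tilt v) = moment v - (norm v)\<^sup>2"
proof -
  interpret T: prob_space "tilt v" using v by (rule prob_space_tilt)
  have i: "integrable (tilt v) (\<lambda>x. prec *v x - v)" using v by (intro integral_tilt continuous_intros)
  \<comment> \<open>Arranged so that the cross term pairs \<open>v\<close> with the centred
    variable, whose integral vanishes.\<close>
  have "(norm (prec *v x - v))\<^sup>2 = (norm (prec *v x))\<^sup>2 - (2 * (v \<bullet> (prec *v x - v)) + (norm v)\<^sup>2)" for x
    by (simp add: power2_norm_eq_inner inner_diff_left inner_diff_right inner_commute)
  then have "(\<integral>x. (norm (prec *v x - v))\<^sup>2 \<partial>tilt v)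
     = (\<integral>x. (norm (prec *v x))\<^sup>2 - (2 * (v \<bullet> (prec *v x - v)) + (norm v)\<^sup>2) \<partial>tilt v)" by simp
  also have "\<dots> = (\<integral>x. (norm (prec *v x))\<^sup>2 \<partial>tilt v) - (\<integral>x. 2 * (v \<bullet> (prec *v x - v)) + (norm v)\<^sup>2 \<partial>tilt v)"
    using v by (intro Bochner_Integration.integral_diff integral_tilt continuous_intros)
  also have "(\<integral>x. 2 * (v \<bullet> (prec *v x - v)) + (norm v)\<^sup>2 \<partial>tilt v)
     = (\<integral>x. 2 * (v \<bullet> (prec *v x - v)) \<partial>tilt v) + (norm v)\<^sup>2"
    using v by (subst Bochner_Integration.integral_add) (auto simp: T.prob_space intro!: integral_tilt continuous_intros)
  also have "(\<integral>x. 2 * (v \<bullet> (prec *v x - v)) \<partial>tilt v) = 0"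
    using integral_inner_right[of v "tilt v" "\<lambda>x. prec *v x - v"] i tilt_mean[OF assms] by simp
  also have "(\<integral>x. (norm (prec *v x))\<^sup>2 \<partial>tilt v) = moment v"
    unfolding moment_def using v by (subst integral_tilt) (auto intro!: continuous_intros)
  finally show ?thesis by simp
qed

text \<open>The users may have different tilts as long as these average to
  \<open>hvec H \<theta>\<close>. The estimation error is then \<open>H\<close> applied to an
  average of independent centred vectors, and \<open>H\<close> preserves norms.\<close>

lemma risk_product:
  assumes inv: "invertible (Sigma_mat \<rho>)" and v: "\<And>m. admissible (v m)"
    and \<theta>: "\<theta> \<in> prob_simplex" and avg: "(1 / real n) *\<^sub>R (\<Sum>m<n. v m) = hvec H \<theta>"
  shows "(\<integral>X. (norm (est H \<rho> n X - \<theta>))\<^sup>2 \<partial>PiM {..<n} (\<lambda>m. tilt (v m)))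
    = (1 / real n)\<^sup>2 * (\<Sum>m<n. moment (v m) - (norm (v m))\<^sup>2)"
proof -
  interpret P: product_prob_space "\<lambda>m. tilt (v m)" "{..<n}"
    using v by (intro product_prob_spaceI prob_space_tilt)
  have "(norm (est H \<rho> n X - \<theta>))\<^sup>2 = (1 / real n)\<^sup>2 * (norm (\<Sum>m<n. prec *v X m - v m))\<^sup>2" for X
  proof -
    have "est H \<rho> n X - \<theta> = H *v (prec *v ((1 / real n) *\<^sub>R (\<Sum>m<n. X m))) - H *v hvec H \<theta>"
      unfolding H_hvec[OF \<theta>] est_def prec_def by simp
    also have "prec *v ((1 / real n) *\<^sub>R (\<Sum>m<n. X m)) = (1 / real n) *\<^sub>R (\<Sum>m<n. prec *v X m)"
      by (simp add: linear_scale[OF matrix_vector_mul_linear] linear_sum[OF matrix_vector_mul_linear])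
    also have "H *v ((1 / real n) *\<^sub>R (\<Sum>m<n. prec *v X m)) - H *v hvec H \<theta>
        = H *v ((1 / real n) *\<^sub>R (\<Sum>m<n. prec *v X m) - hvec H \<theta>)"
      by (rule matrix_vector_mult_diff_distrib[symmetric])
    also have "\<dots> = H *v ((1 / real n) *\<^sub>R (\<Sum>m<n. prec *v X m - v m))"
      unfolding avg[symmetric] by (simp add: sum_subtractf scaleR_diff_right)
    finally show ?thesis by (simp add: norm_H power_mult_distrib power_divide)
  qed
  then have "(\<integral>X. (norm (est H \<rho> n X - \<theta>))\<^sup>2 \<partial>PiM {..<n} (\<lambda>m. tilt (v m)))
     = (1 / real n)\<^sup>2 * (\<integral>X. (norm (\<Sum>m<n. prec *v X m - v m))\<^sup>2 \<partial>PiM {..<n} (\<lambda>m. tilt (v m)))"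
    by (simp only: integral_mult_right_zero)
  also have "(\<integral>X. (norm (\<Sum>m<n. prec *v X m - v m))\<^sup>2 \<partial>PiM {..<n} (\<lambda>m. tilt (v m)))
     = (\<Sum>m<n. \<integral>x. (norm (prec *v x - v m))\<^sup>2 \<partial>tilt (v m))"
  proof (rule P.centred_sum_norm_sq)
    show "integrable (tilt (v m)) (\<lambda>x. prec *v x - v m)" for m
      using v by (intro integral_tilt continuous_intros)
    show "integrable (tilt (v m)) (\<lambda>x. (norm (prec *v x - v m))\<^sup>2)" for m
      using v by (intro integral_tilt continuous_intros)
  qed (simp_all add: tilt_mean[OF inv v])
  finally show ?thesis using tilt_variance[OF inv v] by simp
qed

text \<open>The tilted density is the \<theta>-average of the \<open>cells\<close>, and the moment
  is linear in the density.\<close>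

lemma moment_hvec:
  assumes "\<theta> \<in> prob_simplex"
  shows "moment (hvec H \<theta>) = (\<Sum>i\<in>UNIV. \<theta>$i * moment (H$i))"
proof -
  have "moment (hvec H \<theta>) = (\<integral>x. (\<Sum>i\<in>UNIV. \<theta>$i * ((1 + H$i \<bullet> x) * (norm (prec *v x))\<^sup>2)) \<partial>\<rho>)"
    unfolding moment_def mix_cells[OF assms] cells_nth by (simp add: sum_distrib_right mult.assoc)
  also have "\<dots> = (\<Sum>i\<in>UNIV. \<theta>$i * moment (H$i))"
    unfolding moment_def
    by (subst Bochner_Integration.integral_sum) (auto intro!: integrable_cont continuous_intros)
  finally show ?thesis .
qed

lemma R_iid_eq:
  assumes inv: "invertible (Sigma_mat \<rho>)" and n: "n \<ge> 1" and \<theta>: "\<theta> \<in> prob_simplex"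
  shows "R_iid H n \<rho> \<theta> = ereal ((1 / real n) * (moment (hvec H \<theta>) - (norm (hvec H \<theta>))\<^sup>2))"
proof -
  have avg: "(1 / real n) *\<^sub>R (\<Sum>m<n. hvec H \<theta>) = hvec H \<theta>" using n by (simp add: sum_constant_scaleR del: sum_constant)
  have "law_theta H \<rho> \<theta> = tilt (hvec H \<theta>)" by (simp add: law_theta_def tilt_def)
  then show ?thesis
    unfolding R_iid_def using risk_product[OF inv admissible_hvec[OF \<theta>] \<theta> avg] inv n
    by (simp add: power2_eq_square)
qed

end

section \<open>Risk under a fixed composition\<close>

lemma exists_assignment:
  fixes f :: "'a::finite \<Rightarrow> nat"
  assumes "(\<Sum>i\<in>UNIV. f i) = n"
  shows "\<exists>c :: nat \<Rightarrow> 'a. \<forall>i. card {m\<in>{..<n}. c m = i} = f i"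
  using assms
proof (induction n arbitrary: f)
  case 0
  then show ?case by auto
next
  case (Suc n)
  \<comment> \<open>User \<open>n\<close> is given a category with positive demand, and the
    induction hypothesis applies to the demand lowered by one there.\<close>
  then obtain j where j: "f j > 0" by (metis gr0I nat.simps(3) sum.neutral)
  define g where "g = f(j := f j - 1)"
  have "sum f UNIV = f j + sum f (UNIV - {j})" "sum g UNIV = g j + sum g (UNIV - {j})"
    by (simp_all add: sum.remove)
  moreover have "sum g (UNIV - {j}) = sum f (UNIV - {j})" by (intro sum.cong) (auto simp: g_def)
  ultimately have "sum g UNIV = n" using Suc.prems j by (simp add: g_def)
  from Suc.IH[OF this] obtain c where c: "\<And>i. card {m\<in>{..<n}. c m = i} = g i" by blast
  have "card {m\<in>{..<Suc n}. (c(n := j)) m = i} = f i" for i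
  proof (cases "i = j")
    case True
    have "{m\<in>{..<Suc n}. (c(n := j)) m = i} = insert n {m\<in>{..<n}. c m = i}"
      using True by (auto simp: less_Suc_eq)
    then have "card {m\<in>{..<Suc n}. (c(n := j)) m = i} = Suc (g i)"
      by (simp add: c[symmetric])
    then show ?thesis using True j by (simp add: g_def)
  next
    case False
    have "{m\<in>{..<Suc n}. (c(n := j)) m = i} = {m\<in>{..<n}. c m = i}"
      using False by (auto simp: less_Suc_eq)
    then have "card {m\<in>{..<Suc n}. (c(n := j)) m = i} = g i"
      by (simp only: c)
    then show ?thesis using False by (simp only: g_def fun_upd_apply if_False)
  qed
  then show ?case by (intro exI[of _ "c(n := j)"]) (simp only: simp_thms)
qed

text \<open>The demands are nonnegative integers of sum \<open>n\<close>, so an assignment exists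
  and the choice in \<open>assign\<close> has the required property.\<close>

lemma assign_card:
  assumes "\<theta> \<in> fc_thetas n"
  shows "real (card {m\<in>{..<n}. assign n \<theta> m = i}) = real n * \<theta>$i"
proof -
  have \<theta>: "\<And>i. 0 \<le> \<theta>$i" "(\<Sum>i\<in>UNIV. \<theta>$i) = 1" "\<And>i. real n * \<theta>$i \<in> \<int>"
    using assms by (auto simp: fc_thetas_def prob_simplex_def)
  define f where "f i = nat \<lfloor>real n * \<theta>$i\<rfloor>" for i
  have f: "real (f i) = real n * \<theta>$i" for i
    using \<theta>(1,3)[of i] by (simp add: f_def of_nat_nat Ints_def)
  have "real (\<Sum>i\<in>UNIV. f i) = real n"
    by (simp add: f \<theta>(2) flip: sum_distrib_left)
  then have "(\<Sum>i\<in>UNIV. f i) = n" by linarith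
  from exists_assignment[OF this] have "\<exists>c. \<forall>i. real (card {m\<in>{..<n}. c m = i}) = real n * \<theta>$i"
    by (metis f)
  then have "\<forall>i. real (card {m\<in>{..<n}. assign n \<theta> m = i}) = real n * \<theta>$i"
    unfolding assign_def by (rule someI_ex)
  then show ?thesis by blast
qed

text \<open>Every user is tilted by a row of \<open>H\<close>, and all rows have the same squared
  norm. The subtracted term is therefore a constant here, in contrast to the squared norm of
  \<open>hvec\<close> in the i.i.d. design; this accounts for the gap between the two minimax
  values.\<close>

lemma (in anchored_law) R_fc_eq:
  assumes inv: "invertible (Sigma_mat \<rho>)" and n: "n \<ge> 1" and \<theta>: "\<theta> \<in> fc_thetas n"
  shows "R_fc H n \<rho> \<theta> = ereal ((1 / real n) * (moment (hvec H \<theta>) - (1 - 1 / real CARD('d))))"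
proof -
  have ps: "\<theta> \<in> prob_simplex" using \<theta> by (simp add: fc_thetas_def)
  \<comment> \<open>A sum over users, regrouped by category.\<close>
  have group: "(\<Sum>m<n. g (assign n \<theta> m)) = real n * (\<Sum>i\<in>UNIV. \<theta>$i * g i)" for g :: "'d \<Rightarrow> real"
    using sum_fun_comp[of "{..<n}" UNIV "assign n \<theta>" g] assign_card[OF \<theta>]
    by (simp add: sum_distrib_left mult.assoc)
  have avg: "(1 / real n) *\<^sub>R (\<Sum>m<n. H$(assign n \<theta> m)) = hvec H \<theta>"
    using n group[of "\<lambda>i. H$i$j" for j] by (simp add: vec_eq_iff hvec_eq)
  have "(\<Sum>m<n. moment (H$(assign n \<theta> m)) - (norm (H$(assign n \<theta> m)))\<^sup>2)
     = real n * (\<Sum>i\<in>UNIV. \<theta>$i * (moment (H$i) - (1 - 1 / real CARD('d))))"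
    using group[of "\<lambda>i. moment (H$i) - (1 - 1 / real CARD('d))"] by (simp add: norm_row)
  also have "(\<Sum>i\<in>UNIV. \<theta>$i * (moment (H$i) - (1 - 1 / real CARD('d)))) = moment (hvec H \<theta>) - (1 - 1 / real CARD('d))"
    using ps by (simp add: moment_hvec[OF ps] right_diff_distrib sum_subtractf prob_simplex_def flip: sum_distrib_right sum_divide_distrib)
  finally have s: "(\<Sum>m<n. moment (H$(assign n \<theta> m)) - (norm (H$(assign n \<theta> m)))\<^sup>2)
     = real n * (moment (hvec H \<theta>) - (1 - 1 / real CARD('d)))" .
  have "law_i H \<rho> i = tilt (H$i)" for i by (simp add: law_i_def tilt_def gam_eq_row)
  then show ?thesis
    unfolding R_fc_def using risk_product[OF inv admissible_row ps avg, unfolded s] inv n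
    by (simp add: power2_eq_square)
qed

section \<open>Minimax bounds\<close>

lemma anchored_lawI:
  fixes H :: "real^'k^'d"
  assumes "valid_H H" "anchored H \<rho>"
  shows "anchored_law H \<rho>"
proof -
  interpret centred_frame H by standard fact
  interpret prob_space \<rho> using assms(2) by (simp add: anchored_def)
  show ?thesis
  proof
    show "AE x in \<rho>. x \<in> Xd H"
      using assms(2) by (intro AE_prob_1) (simp add: anchored_def measure_def)
  qed (use assms(2) in \<open>auto simp: anchored_def\<close>)
qed

section \<open>Privacy as a pointwise ratio bound, and lower bounds on the risk\<close>

context anchored_law
begin

lemma Wch_eq: "Wch H \<rho> B i = (\<integral>x. indicator B x * cells H x $ i \<partial>\<rho>)"
  by (simp add: Wch_def gam_eq_row set_lebesgue_integral_def)

lemma integrable_cells: "integrable \<rho> (\<lambda>x. cells H x $ i)"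
  unfolding cells_nth by (intro integrable_cont continuous_intros)

lemma integrable_indicator_cells:
  assumes "B \<in> sets borel"
  shows "integrable \<rho> (\<lambda>x. indicator B x * cells H x $ i)"
  using integrable_mult_indicator[OF _ integrable_cells, of B i] assms by simp

text \<open>Test privacy on the set where the pointwise bound fails: the excess is nonnegative with
  integral at most 0, hence zero almost everywhere. Finitely many pairs of indices combine into one
  null set.\<close>

lemma LDP_imp_ratio:
  assumes "LDP H \<epsilon> \<rho>"
  shows "AE x in \<rho>. \<forall>i j. cells H x $ j \<le> exp \<epsilon> * cells H x $ i"
proof -
  have "AE x in \<rho>. cells H x $ j \<le> exp \<epsilon> * cells H x $ i" for i j
  proof -
    define B where "B = {x. exp \<epsilon> * cells H x $ i < cells H x $ j}"
    have B: "B \<in> sets borel"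
      unfolding B_def cells_nth by (intro borel_open open_Collect_less continuous_intros)
    define f where "f x = indicator B x * cells H x $ j - exp \<epsilon> * (indicator B x * cells H x $ i)" for x
    have f: "integrable \<rho> f"
      unfolding f_def using B by (intro Bochner_Integration.integrable_diff integrable_mult_right integrable_indicator_cells)
    have nonneg: "0 \<le> f x" for x by (simp add: f_def B_def indicator_def)
    have "integral\<^sup>L \<rho> f = Wch H \<rho> B j - exp \<epsilon> * Wch H \<rho> B i"
      unfolding f_def Wch_eq
      by (subst Bochner_Integration.integral_diff) (simp_all add: integrable_indicator_cells B del: cells_nth)
    also have "\<dots> \<le> 0" using assms B by (simp add: LDP_def)
    finally have "integral\<^sup>L \<rho> f \<le> 0" .
    moreover have "integral\<^sup>L \<rho> f \<ge> 0" using nonneg by (intro integral_nonneg_AE) simp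
    ultimately have "AE x in \<rho>. f x = 0"
      using integral_nonneg_eq_0_iff_AE[OF f] nonneg by simp
    then show ?thesis
      by eventually_elim (auto simp: f_def B_def indicator_def split: if_splits)
  qed
  then show ?thesis by (simp add: AE_all_countable del: cells_nth)
qed

lemma ratio_imp_LDP:
  assumes "AE x in \<rho>. \<forall>i j. cells H x $ j \<le> exp \<epsilon> * cells H x $ i"
  shows "LDP H \<epsilon> \<rho>"
  unfolding LDP_def
proof (intro ballI allI)
  fix B :: "(real^'k) set" and i j assume B: "B \<in> sets borel"
  have "Wch H \<rho> B j \<le> (\<integral>x. exp \<epsilon> * (indicator B x * cells H x $ i) \<partial>\<rho>)"
    unfolding Wch_eq
  proof (rule integral_mono_AE)
    show "AE x in \<rho>. indicator B x * cells H x $ j \<le> exp \<epsilon> * (indicator B x * cells H x $ i)"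
      using assms by eventually_elim (simp add: indicator_def del: cells_nth)
  qed (intro integrable_mult_right integrable_indicator_cells B)+
  then show "Wch H \<rho> B j \<le> exp \<epsilon> * Wch H \<rho> B i" by (simp add: Wch_eq del: cells_nth)
qed

lemma moment_lower:
  assumes inv: "invertible (Sigma_mat \<rho>)"
  shows "2 * c * real CARD('k) - c\<^sup>2 * (\<integral>x. (norm x)\<^sup>2 \<partial>\<rho>) \<le> moment 0"
proof -
  have sq: "(norm (prec *v x - c *\<^sub>R x))\<^sup>2 = (norm (prec *v x))\<^sup>2 - 2 * c * ((prec *v x) \<bullet> x) + c\<^sup>2 * (norm x)\<^sup>2" for x
    unfolding power2_norm_eq_inner
    by (simp add: inner_diff_left inner_diff_right inner_commute power2_eq_square algebra_simps)
  have "0 \<le> (\<integral>x. (norm (prec *v x - c *\<^sub>R x))\<^sup>2 \<partial>\<rho>)" by simp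
  also have "\<dots> = (\<integral>x. (norm (prec *v x))\<^sup>2 - 2 * c * ((prec *v x) \<bullet> x) \<partial>\<rho>) + (\<integral>x. c\<^sup>2 * (norm x)\<^sup>2 \<partial>\<rho>)"
    unfolding sq by (intro Bochner_Integration.integral_add integrable_cont continuous_intros)
  also have "(\<integral>x. (norm (prec *v x))\<^sup>2 - 2 * c * ((prec *v x) \<bullet> x) \<partial>\<rho>)
      = (\<integral>x. (norm (prec *v x))\<^sup>2 \<partial>\<rho>) - (\<integral>x. 2 * c * ((prec *v x) \<bullet> x) \<partial>\<rho>)"
    by (intro Bochner_Integration.integral_diff integrable_cont continuous_intros)
  also have "(\<integral>x. (norm (prec *v x))\<^sup>2 \<partial>\<rho>) = moment 0" by (simp add: moment_def)
  \<comment> \<open>The expected inner product is the trace of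
    \<open>prec ** Sigma_mat \<rho>\<close>, the identity of size \<open>CARD('k)\<close>.\<close>
  also have "(\<integral>x. 2 * c * ((prec *v x) \<bullet> x) \<partial>\<rho>) = 2 * c * real CARD('k)"
    by (simp add: inner_moment prec_mult[OF inv] trace_I)
  finally show ?thesis by simp
qed

lemma moment_average: "(\<Sum>i\<in>UNIV. moment (H$i)) = real CARD('d) * moment 0"
  using moment_hvec[OF uniform_in_simplex] by (simp add: hvec_uniform flip: sum_divide_distrib)

text \<open>At the uniform vector the tilt is zero. The first alternative covers a singular
  second-moment matrix; the second keeps invertibility available for the equality case.\<close>

lemma R_iid_lower:
  assumes n: "n \<ge> 1"
  shows "(SUP \<theta>\<in>prob_simplex. R_iid H n \<rho> \<theta>) = \<infinity>
    \<or> invertible (Sigma_mat \<rho>) \<and> ereal ((1 / real n) * moment 0) \<le> (SUP \<theta>\<in>prob_simplex. R_iid H n \<rho> \<theta>)"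
proof -
  define u where "u = (\<chi> i. 1 / real CARD('d) :: real^'d)"
  have u: "u \<in> prob_simplex" unfolding u_def by (rule uniform_in_simplex)
  then have le: "R_iid H n \<rho> u \<le> (SUP \<theta>\<in>prob_simplex. R_iid H n \<rho> \<theta>)" by (rule SUP_upper)
  show ?thesis
  proof (cases "invertible (Sigma_mat \<rho>)")
    case True
    have "hvec H u = 0" unfolding u_def by (rule hvec_uniform)
    then show ?thesis using le True by (simp add: R_iid_eq[OF True n u])
  next
    case False
    then show ?thesis using le by (simp add: R_iid_def)
  qed
qed

text \<open>Vertices have integer counts for every \<open>n\<close>, whereas the uniform vector
  requires \<open>d\<close> to divide \<open>n\<close>; hence the lower bound averages over
  vertices.\<close>

lemma axis_in_fc_thetas: "axis i 1 \<in> (fc_thetas n :: (real^'d) set)"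
  using axis_in_simplex[of i] by (simp add: fc_thetas_def) (simp add: axis_def)

lemma R_fc_lower:
  assumes n: "n \<ge> 1"
  shows "(SUP \<theta>\<in>fc_thetas n. R_fc H n \<rho> \<theta>) = \<infinity>
    \<or> invertible (Sigma_mat \<rho>) \<and>
      ereal ((1 / real n) * (moment 0 - (1 - 1 / real CARD('d)))) \<le> (SUP \<theta>\<in>fc_thetas n. R_fc H n \<rho> \<theta>)"
proof (cases "invertible (Sigma_mat \<rho>)")
  case True
  \<comment> \<open>The row moments average to \<open>moment 0\<close>, so at least one of them is
    no smaller.\<close>
  have "\<exists>i. moment 0 \<le> moment (H$i)"
  proof (rule ccontr)
    assume "\<not> ?thesis"
    then have "(\<Sum>i\<in>UNIV. moment (H$i)) < (\<Sum>i\<in>(UNIV :: 'd set). moment 0)"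
      by (intro sum_strict_mono) (auto simp: not_le)
    then show False by (simp add: moment_average)
  qed
  then obtain i where i: "moment 0 \<le> moment (H$i)" ..
  have "ereal ((1 / real n) * (moment 0 - (1 - 1 / real CARD('d)))) \<le> R_fc H n \<rho> (axis i 1)"
    unfolding R_fc_eq[OF True n axis_in_fc_thetas] using i n by (auto intro!: divide_right_mono)
  also have "\<dots> \<le> (SUP \<theta>\<in>fc_thetas n. R_fc H n \<rho> \<theta>)"
    by (intro SUP_upper axis_in_fc_thetas)
  finally show ?thesis using True by simp
next
  case False
  \<comment> \<open>Any vertex serves, since a singular matrix makes the risk infinite at every
    composition.\<close>
  have "R_fc H n \<rho> (axis undefined 1) \<le> (SUP \<theta>\<in>fc_thetas n. R_fc H n \<rho> \<theta>)"
    by (intro SUP_upper axis_in_fc_thetas)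
  then show ?thesis using False by (simp add: R_fc_def)
qed

end

section \<open>Laws concentrated on the optimal orbits\<close>

context optimal_frame
begin

lemma ratio_norm:
  assumes "\<And>i j. cells H x $ j \<le> lam * cells H x $ i"
  shows "(norm x)\<^sup>2 \<le> T_star CARD('d) lam"
    and "(norm x)\<^sup>2 = T_star CARD('d) lam \<Longrightarrow> x \<in> optima"
proof -
  note ext = two_level_extremal[OF d2 lam sum_cells assms]
  show "(norm x)\<^sup>2 \<le> T_star CARD('d) lam" unfolding norm_sq_cells using ext(1) .
  assume "(norm x)\<^sup>2 = T_star CARD('d) lam"
  then obtain A where A: "card A \<in> S_star CARD('d) lam" "cells H x = level lam A"
    using ext(2) unfolding norm_sq_cells by blast
  then have "x = xa H (level lam A)" using xa_cells[of x] by simp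
  then show "x \<in> optima"
    unfolding optima_def orbit_def using A(1) by blast
qed

lemma optima_props:
  assumes "x \<in> optima"
  shows "0 < cells H x $ i" "cells H x $ j \<le> lam * cells H x $ i" "(norm x)\<^sup>2 = T_star CARD('d) lam"
proof -
  obtain A :: "'d set" where A: "card A \<in> S_star CARD('d) lam" "x = xa H (level lam A)"
    using assms by (auto simp: optima_def orbit_def)
  then have "cells H x = level lam A" by (simp add: cells_xa sum_level[OF lam])
  then show "0 < cells H x $ i" "cells H x $ j \<le> lam * cells H x $ i" "(norm x)\<^sup>2 = T_star CARD('d) lam"
    unfolding norm_sq_cells using level_two_level[OF lam A(1)] by simp_all
qed

lemma card_k: "real CARD('k) = real CARD('d) - 1" "real CARD('k) > 0"
  using valid d2 by (auto simp: valid_H_def of_nat_diff)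

lemma T_pos: "T_star CARD('d) lam > 0"
  by (rule T_star_pos[OF d2 lam])

lemma exchangeable_integral:
  fixes f :: "real^'k \<Rightarrow> real"
  assumes "exchangeable H \<rho>" "sets \<rho> = sets borel" "\<pi> permutes (UNIV :: 'd set)" "f \<in> borel_measurable borel"
  shows "(\<integral>x. f (Pmat H \<pi> *v x) \<partial>\<rho>) = (\<integral>x. f x \<partial>\<rho>)"
proof -
  have "(\<integral>x. f x \<partial>\<rho>) = (\<integral>x. f x \<partial>distr \<rho> borel (\<lambda>x. Pmat H \<pi> *v x))"
    using assms by (simp add: exchangeable_def)
  also have "\<dots> = (\<integral>x. f (Pmat H \<pi> *v x) \<partial>\<rho>)"
    using assms(4) Pmat_measurable[of \<pi>] by (intro integral_distr) (simp_all add: measurable_cong_sets[OF assms(2) refl])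
  finally show ?thesis ..
qed

lemma rows_Pmat:
  "\<pi> permutes (UNIV :: 'd set) \<Longrightarrow> H$i \<bullet> (Pmat H \<pi> *v x) = H$(inv \<pi> i) \<bullet> x"
  using cells_Pmat[of \<pi> x i] by simp

lemma eq_0_if_rows_0:
  assumes "\<And>i. H$i \<bullet> y = 0"
  shows "y = 0"
proof -
  have "cells H y = cells H 0" using assms by (simp add: vec_eq_iff)
  then show ?thesis by (simp add: cells_inj)
qed

text \<open>Transpositions give the mean equal inner products with all rows of \<open>H\<close>. The
  rows sum to zero, so these products vanish and the mean is 0.\<close>

lemma optimal_law_anchored:
  assumes "optimal_law \<rho>"
  shows "anchored H \<rho>" "anchored_law H \<rho>"
proof -
  from assms interpret prob_space \<rho> by (simp add: optimal_law_def)
  have s[simp, measurable_cong]: "sets \<rho> = sets borel" and ex: "exchangeable H \<rho>" and ae: "AE x in \<rho>. x \<in> optima"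
    using assms by (auto simp: optimal_law_def)
  have int: "integrable \<rho> (\<lambda>x. x)"
  proof (rule integrable_const_bound)
    show "AE x in \<rho>. norm x \<le> sqrt (T_star CARD('d) lam)"
      using ae by eventually_elim (use optima_props(3) in \<open>intro real_le_rsqrt, simp\<close>)
  qed simp
  define y where "y = (\<integral>x. x \<partial>\<rho>)"
  have Hy: "H$i \<bullet> y = (\<integral>x. H$i \<bullet> x \<partial>\<rho>)" for i
    unfolding y_def using int by simp
  have eq: "H$i \<bullet> y = H$j \<bullet> y" for i j
  proof -
    have p: "Transposition.transpose i j permutes (UNIV :: 'd set)" by (simp add: permutes_swap_id)
    have "H$i \<bullet> y = (\<integral>x. H$i \<bullet> (Pmat H (Transposition.transpose i j) *v x) \<partial>\<rho>)"
      unfolding Hy by (rule exchangeable_integral[OF ex s p, symmetric]) measurable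
    also have "\<dots> = H$j \<bullet> y" unfolding rows_Pmat[OF p] Hy by simp
    finally show ?thesis .
  qed
  have "y = 0"
  proof (rule eq_0_if_rows_0)
    fix i
    have "(\<Sum>j\<in>UNIV. H$j \<bullet> y) = 0" using sum_H[of y] by (simp add: mv_component)
    moreover have "(\<Sum>j\<in>UNIV. H$j \<bullet> y) = (\<Sum>j\<in>(UNIV :: 'd set). H$i \<bullet> y)" by (intro sum.cong eq refl)
    ultimately show "H$i \<bullet> y = 0" by simp
  qed
  have Xd: "AE x in \<rho>. x \<in> Xd H"
    using ae by eventually_elim (auto simp: Xd_eq less_imp_le[OF optima_props(1)] simp del: cells_nth)
  have "Xd H \<in> sets borel"
    unfolding Xd_def by (intro borel_closed closed_Collect_all closed_Collect_le continuous_intros)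
  then have "emeasure \<rho> (Xd H) = 1"
    using Xd by (intro emeasure_eq_1_AE) simp_all
  then show "anchored H \<rho>"
    unfolding anchored_def using prob_space_axioms int \<open>y = 0\<close> by (simp add: y_def)
  then show "anchored_law H \<rho>" using valid by (intro anchored_lawI)
qed

lemma optimal_law_feasible:
  assumes "optimal_law \<rho>" "lam = exp \<epsilon>"
  shows "\<rho> \<in> feasible H \<epsilon>"
proof -
  interpret anchored_law H \<rho> by (rule optimal_law_anchored) fact
  have "AE x in \<rho>. x \<in> optima" using assms(1) by (simp add: optimal_law_def)
  then have "AE x in \<rho>. \<forall>i j. cells H x $ j \<le> exp \<epsilon> * cells H x $ i"
    by eventually_elim (metis optima_props(2) assms(2))
  then show ?thesis
    unfolding feasible_def using ratio_imp_LDP optimal_law_anchored(1)[OF assms(1)] by blast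
qed

text \<open>The second moments \<open>m\<close> in cell coordinates are invariant under
  transpositions, so they have one diagonal and one off-diagonal value. Zero row sums and the trace,
  which equals \<open>T_star\<close>, determine both, and the result is a multiple of the Gram
  matrix of the rows of \<open>H\<close>.\<close>

lemma optimal_law_Sigma:
  assumes "optimal_law \<rho>"
  shows "Sigma_mat \<rho> *v y = (T_star CARD('d) lam / real CARD('k)) *\<^sub>R y"
proof -
  interpret anchored_law H \<rho> by (rule optimal_law_anchored) fact
  have ex: "exchangeable H \<rho>" and ae: "AE x in \<rho>. x \<in> optima"
    using assms by (auto simp: optimal_law_def)
  define T where "T = T_star CARD('d) lam"
  define d where "d = real CARD('d)"
  have d: "d \<ge> 2" using d2 by (simp add: d_def)
  define m where "m i j = (\<integral>x. (H$i \<bullet> x) * (H$j \<bullet> x) \<partial>\<rho>)" for i j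
  have int: "integrable \<rho> (\<lambda>x. (H$i \<bullet> x) * (H$j \<bullet> x))" for i j
    by (intro integrable_cont continuous_intros)
  have swap: "m i j = m (Transposition.transpose a b i) (Transposition.transpose a b j)" for i j a b
  proof -
    have p: "Transposition.transpose a b permutes (UNIV :: 'd set)" by (simp add: permutes_swap_id)
    have "m i j = (\<integral>x. (H$i \<bullet> (Pmat H (Transposition.transpose a b) *v x)) * (H$j \<bullet> (Pmat H (Transposition.transpose a b) *v x)) \<partial>\<rho>)"
      unfolding m_def by (rule exchangeable_integral[OF ex sets_rho p, symmetric]) measurable
    then show ?thesis unfolding rows_Pmat[OF p] m_def by simp
  qed
  have diag: "m i i = m j j" for i j using swap[of i i i j] by simp
  \<comment> \<open>The transposition of \<open>j\<close> and \<open>l\<close> fixes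
    \<open>i\<close>.\<close>
  have off: "m i j = m i l" if "j \<noteq> i" "l \<noteq> i" for i j l
    using swap[of i j j l] that by (simp add: transpose_apply_other)
  have row: "(\<Sum>j\<in>UNIV. m i j) = 0" for i
  proof -
    have "(\<Sum>j\<in>UNIV. m i j) = (\<integral>x. (\<Sum>j\<in>UNIV. (H$i \<bullet> x) * (H$j \<bullet> x)) \<partial>\<rho>)"
      unfolding m_def using int by (intro Bochner_Integration.integral_sum[symmetric])
    also have "\<dots> = 0" using sum_H by (simp add: mv_component flip: sum_distrib_left)
    finally show ?thesis .
  qed
  have total: "(\<Sum>i\<in>UNIV. m i i) = T"
  proof -
    have "(\<Sum>i\<in>UNIV. m i i) = (\<integral>x. (\<Sum>i\<in>UNIV. (H$i \<bullet> x) * (H$i \<bullet> x)) \<partial>\<rho>)"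
      unfolding m_def using int by (intro Bochner_Integration.integral_sum[symmetric])
    also have "\<dots> = (\<integral>x. (norm x)\<^sup>2 \<partial>\<rho>)" by (simp add: norm_sq_cells flip: power2_eq_square)
    also have "\<dots> = (\<integral>x. T \<partial>\<rho>)"
      by (rule integral_cong_AE, measurable) (use ae in eventually_elim, simp add: optima_props(3) T_def)
    finally show ?thesis by (simp add: prob_UNIV)
  qed
  have mii: "m i i = T / d" for i
  proof -
    have "(\<Sum>j\<in>UNIV. m j j) = (\<Sum>j\<in>(UNIV :: 'd set). m i i)" by (rule sum.cong[OF refl diag])
    also have "\<dots> = d * m i i" by (simp add: d_def)
    finally have "(\<Sum>j\<in>UNIV. m j j) = d * m i i" .
    then show ?thesis using total d by (simp add: field_simps)
  qed
  have mij: "m i j = - T / (d * (d - 1))" if "j \<noteq> i" for i j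
  proof -
    have "(\<Sum>l\<in>UNIV. m i l) = m i i + (\<Sum>l\<in>UNIV - {i}. m i l)" by (simp add: sum.remove)
    also have "(\<Sum>l\<in>UNIV - {i}. m i l) = (\<Sum>l\<in>UNIV - {i}. m i j)"
      by (rule sum.cong[OF refl off]) (use that in auto)
    also have "\<dots> = (d - 1) * m i j" by (simp add: d_def card_Diff_singleton of_nat_diff)
    finally have "m i j * (d - 1) = - (T / d)" by (simp add: row mii mult.commute)
    then have "m i j = - (T / d) / (d - 1)" by (intro eq_divide_imp) (use d in auto)
    then show ?thesis by simp
  qed
  \<comment> \<open>The Gram entries of the rows are the entries of the projection
    \<open>H ** transpose H\<close>.\<close>
  have gram: "H$j \<bullet> H$i = (if i = j then 1 else 0) - 1 / d" for i j
  proof -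
    have "H$j \<bullet> H$i = (H *v hvec H (axis i 1)) $ j" by (simp add: mv_component)
    also have "\<dots> = (if i = j then 1 else 0) - 1 / d"
      unfolding H_hvec[OF axis_in_simplex] by (simp add: axis_def d_def)
    finally show ?thesis .
  qed
  have k: "real CARD('k) = d - 1" using card_k(1) by (simp add: d_def)
  have row_eigen: "Sigma_mat \<rho> *v H$i = (T / (d - 1)) *\<^sub>R H$i" for i
  proof -
    have "Sigma_mat \<rho> *v H$i - (T / (d - 1)) *\<^sub>R H$i = 0"
    proof (rule eq_0_if_rows_0)
      fix j
      have "H$j \<bullet> (Sigma_mat \<rho> *v H$i) = (\<integral>x. H$j \<bullet> ((H$i \<bullet> x) *\<^sub>R x) \<partial>\<rho>)"
        unfolding second_moment_mult[symmetric]
        by (intro integral_inner_right[symmetric] integrable_cont continuous_intros)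
      also have "\<dots> = m i j" by (simp add: m_def)
      also have "\<dots> = T / (d - 1) * (H$j \<bullet> H$i)"
      proof (cases "i = j")
        case True
        have "T / (d - 1) * (1 - 1 / d) = T / d" using d by (simp add: field_simps)
        then show ?thesis using True by (simp add: gram mii)
      next
        case False
        then show ?thesis using mij[of j i] by (simp add: gram mult.commute)
      qed
      finally show "H$j \<bullet> (Sigma_mat \<rho> *v H$i - (T / (d - 1)) *\<^sub>R H$i) = 0"
        by (simp add: inner_diff_right)
    qed
    then show ?thesis by simp
  qed
  \<comment> \<open>The rows span the space, so the eigenvalue equation extends from them to every
    \<open>y\<close> by linearity.\<close>
  have y: "y = (\<Sum>i\<in>UNIV. (H *v y)$i *\<^sub>R H$i)"
    using tH_H[of y] unfolding hvec_eq_transpose[symmetric] hvec_eq by simp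
  have "Sigma_mat \<rho> *v y = (\<Sum>i\<in>UNIV. (H *v y)$i *\<^sub>R (Sigma_mat \<rho> *v H$i))"
    by (subst y) (simp add: linear_sum[OF matrix_vector_mul_linear] linear_scale[OF matrix_vector_mul_linear])
  also have "\<dots> = (T / (d - 1)) *\<^sub>R (\<Sum>i\<in>UNIV. (H *v y)$i *\<^sub>R H$i)"
    unfolding row_eigen by (simp add: scaleR_sum_right mult.commute)
  also have "\<dots> = (T / (d - 1)) *\<^sub>R y" using y by simp
  finally show ?thesis by (simp add: T_def k)
qed

lemma optimal_law_invertible:
  assumes "optimal_law \<rho>"
  shows "invertible (Sigma_mat \<rho>)"
proof -
  have "inj ((*v) (Sigma_mat \<rho>))"
    using T_pos card_k(2) by (intro injI) (simp add: optimal_law_Sigma[OF assms])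
  then show ?thesis
    by (simp add: invertible_left_inverse matrix_left_invertible_injective)
qed

text \<open>The squared norm of \<open>prec *v x\<close> is the same constant at almost every point,
  and the factor \<open>1 + v \<bullet> x\<close> has mean 1. Independence of \<open>v\<close> means
  that no \<theta> is worse than the uniform one as far as the moment is concerned.\<close>

lemma optimal_law_moment:
  assumes opt: "optimal_law \<rho>"
  shows "anchored_law.moment \<rho> v = (real CARD('k))\<^sup>2 / T_star CARD('d) lam"
proof -
  interpret anchored_law H \<rho> by (rule optimal_law_anchored) fact
  define T where "T = T_star CARD('d) lam"
  define k where "k = real CARD('k)"
  have pos: "T > 0" "k > 0" using T_pos card_k(2) by (auto simp: T_def k_def)
  have prec: "prec *v x = (k / T) *\<^sub>R x" for x
  proof -
    have "x = prec *v (Sigma_mat \<rho> *v x)"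
      using prec_mult[OF optimal_law_invertible[OF opt]] by (simp add: matrix_vector_mul_assoc)
    also have "\<dots> = (T / k) *\<^sub>R (prec *v x)"
      by (simp add: optimal_law_Sigma[OF opt] T_def k_def linear_scale[OF matrix_vector_mul_linear])
    finally have "(k / T) *\<^sub>R x = (k / T) *\<^sub>R (T / k) *\<^sub>R (prec *v x)" by simp
    then show ?thesis using pos by simp
  qed
  have "moment v = (\<integral>x. (1 + v \<bullet> x) * (k\<^sup>2 / T) \<partial>\<rho>)"
    unfolding moment_def
  proof (rule integral_cong_AE)
    have "AE x in \<rho>. x \<in> optima" using opt by (simp add: optimal_law_def)
    then show "AE x in \<rho>. (1 + v \<bullet> x) * (norm (prec *v x))\<^sup>2 = (1 + v \<bullet> x) * (k\<^sup>2 / T)"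
    proof eventually_elim
      fix x assume "x \<in> optima"
      then have "(norm x)\<^sup>2 = T" by (simp add: optima_props(3) T_def)
      then have "(norm (prec *v x))\<^sup>2 = k\<^sup>2 / T"
        using pos by (simp add: prec power_mult_distrib power_divide power2_eq_square[of T])
      then show "(1 + v \<bullet> x) * (norm (prec *v x))\<^sup>2 = (1 + v \<bullet> x) * (k\<^sup>2 / T)" by simp
    qed
  qed (intro borel_measurable_integrable integrable_cont continuous_intros)+
  also have "\<dots> = (\<integral>x. 1 + v \<bullet> x \<partial>\<rho>) * (k\<^sup>2 / T)" by (rule integral_mult_left_zero)
  also have "(\<integral>x. 1 + v \<bullet> x \<partial>\<rho>) = 1"
    by (subst Bochner_Integration.integral_add)
       (auto simp: inner_mean_zero prob_UNIV intro!: integrable_cont continuous_intros)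
  finally show ?thesis by (simp add: T_def k_def)
qed

text \<open>The choice \<open>c = k / T\<close> makes \<open>moment_lower\<close> tight when the
  mean squared norm \<tau> equals \<open>T\<close>, its largest possible value. If the bound is
  attained, then \<tau> equals \<open>T\<close>, so the nonnegative function
  \<open>T - (norm x)\<^sup>2\<close> has integral zero and vanishes almost everywhere.\<close>

lemma moment_bound:
  assumes \<rho>: "\<rho> \<in> feasible H \<epsilon>" and \<epsilon>: "lam = exp \<epsilon>" and inv: "invertible (Sigma_mat \<rho>)"
  shows "(real CARD('k))\<^sup>2 / T_star CARD('d) lam \<le> anchored_law.moment \<rho> 0"
    and "anchored_law.moment \<rho> 0 \<le> (real CARD('k))\<^sup>2 / T_star CARD('d) lam \<Longrightarrow> AE x in \<rho>. x \<in> optima"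
proof -
  interpret anchored_law H \<rho> using \<rho> valid by (intro anchored_lawI) (auto simp: feasible_def)
  define T where "T = T_star CARD('d) lam"
  define k where "k = real CARD('k)"
  define \<tau> where "\<tau> = (\<integral>x. (norm x)\<^sup>2 \<partial>\<rho>)"
  have pos: "T > 0" "k > 0" using T_pos card_k(2) by (auto simp: T_def k_def)
  have ratio: "AE x in \<rho>. \<forall>i j. cells H x $ j \<le> lam * cells H x $ i"
    using LDP_imp_ratio[of \<epsilon>] \<rho> unfolding \<epsilon> feasible_def by blast
  have le: "AE x in \<rho>. 0 \<le> T - (norm x)\<^sup>2"
    using ratio by eventually_elim (use ratio_norm(1) in \<open>simp add: T_def\<close>)
  have int: "integrable \<rho> (\<lambda>x. T - (norm x)\<^sup>2)" by (intro integrable_cont continuous_intros)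
  have int_eq: "(\<integral>x. T - (norm x)\<^sup>2 \<partial>\<rho>) = T - \<tau>"
    unfolding \<tau>_def
    by (subst Bochner_Integration.integral_diff) (auto simp: prob_UNIV intro!: integrable_cont continuous_intros)
  then have \<tau>T: "\<tau> \<le> T" using integral_nonneg_AE[OF le] by simp
  have low: "2 * (k\<^sup>2 / T) - (k\<^sup>2 / T) * (\<tau> / T) \<le> moment 0"
    using moment_lower[OF inv, of "k / T"] by (simp add: k_def \<tau>_def power2_eq_square)
  have "(k\<^sup>2 / T) * (\<tau> / T) \<le> (k\<^sup>2 / T) * 1"
    using \<tau>T pos by (intro mult_left_mono) auto
  then show "(real CARD('k))\<^sup>2 / T_star CARD('d) lam \<le> moment 0"
    using low by (simp add: k_def T_def)
  assume "moment 0 \<le> (real CARD('k))\<^sup>2 / T_star CARD('d) lam"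
  then have "(k\<^sup>2 / T) * 1 \<le> (k\<^sup>2 / T) * (\<tau> / T)" using low by (simp add: k_def T_def)
  then have "T \<le> \<tau>" using pos by (subst (asm) mult_le_cancel_left_pos) auto
  then have "(\<integral>x. T - (norm x)\<^sup>2 \<partial>\<rho>) = 0" using int_eq \<tau>T by simp
  then have "AE x in \<rho>. T - (norm x)\<^sup>2 = 0"
    using integral_nonneg_eq_0_iff_AE[OF int le] by simp
  with ratio show "AE x in \<rho>. x \<in> optima"
    by eventually_elim (use ratio_norm(2) in \<open>simp add: T_def\<close>)
qed

section \<open>Minimax values and exchangeable minimizers\<close>

definition value_iid :: "nat \<Rightarrow> real" where
  "value_iid n = (1 / real n) * ((real CARD('k))\<^sup>2 / T_star CARD('d) lam)"

definition value_fc :: "nat \<Rightarrow> real" where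
  "value_fc n = (1 / real n) * ((real CARD('k))\<^sup>2 / T_star CARD('d) lam - (1 - 1 / real CARD('d)))"

text \<open>The last two claims are the equality cases: a finite bound on the worst-case risk rules
  out the infinite alternative, and then \<open>moment 0\<close> has to be minimal.\<close>

lemma value_lower:
  assumes \<rho>: "\<rho> \<in> feasible H \<epsilon>" and \<epsilon>: "lam = exp \<epsilon>" and n: "n \<ge> 1"
  shows "ereal (value_iid n) \<le> (SUP \<theta>\<in>prob_simplex. R_iid H n \<rho> \<theta>)"
    and "ereal (value_fc n) \<le> (SUP \<theta>\<in>fc_thetas n. R_fc H n \<rho> \<theta>)"
    and "(SUP \<theta>\<in>prob_simplex. R_iid H n \<rho> \<theta>) \<le> ereal (value_iid n) \<Longrightarrow> AE x in \<rho>. x \<in> optima"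
    and "(SUP \<theta>\<in>fc_thetas n. R_fc H n \<rho> \<theta>) \<le> ereal (value_fc n) \<Longrightarrow> AE x in \<rho>. x \<in> optima"
proof -
  interpret anchored_law H \<rho> using \<rho> valid by (intro anchored_lawI) (auto simp: feasible_def)
  have n0: "1 / real n > 0" using n by simp
  note mb = moment_bound[OF \<rho> \<epsilon>]
  show "ereal (value_iid n) \<le> (SUP \<theta>\<in>prob_simplex. R_iid H n \<rho> \<theta>)"
    using R_iid_lower[OF n]
  proof (elim disjE conjE)
    assume inv: "invertible (Sigma_mat \<rho>)"
      and le: "ereal ((1 / real n) * moment 0) \<le> (SUP \<theta>\<in>prob_simplex. R_iid H n \<rho> \<theta>)"
    have "value_iid n \<le> (1 / real n) * moment 0"
      unfolding value_iid_def using mb(1)[OF inv] n0 by (intro mult_left_mono) auto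
    then show ?thesis using le by (meson ereal_less_eq(3) order_trans)
  qed simp
  show "ereal (value_fc n) \<le> (SUP \<theta>\<in>fc_thetas n. R_fc H n \<rho> \<theta>)"
    using R_fc_lower[OF n]
  proof (elim disjE conjE)
    assume inv: "invertible (Sigma_mat \<rho>)"
      and le: "ereal ((1 / real n) * (moment 0 - (1 - 1 / real CARD('d)))) \<le> (SUP \<theta>\<in>fc_thetas n. R_fc H n \<rho> \<theta>)"
    have "value_fc n \<le> (1 / real n) * (moment 0 - (1 - 1 / real CARD('d)))"
      unfolding value_fc_def using mb(1)[OF inv] n0 by (intro mult_left_mono) auto
    then show ?thesis using le by (meson ereal_less_eq(3) order_trans)
  qed simp
  show "AE x in \<rho>. x \<in> optima" if up: "(SUP \<theta>\<in>prob_simplex. R_iid H n \<rho> \<theta>) \<le> ereal (value_iid n)"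
    using R_iid_lower[OF n]
  proof (elim disjE conjE)
    assume inv: "invertible (Sigma_mat \<rho>)"
      and le: "ereal ((1 / real n) * moment 0) \<le> (SUP \<theta>\<in>prob_simplex. R_iid H n \<rho> \<theta>)"
    have "(1 / real n) * moment 0 \<le> value_iid n"
      using order_trans[OF le up] by simp
    then show ?thesis
      unfolding value_iid_def mult_le_cancel_left_pos[OF n0] by (rule mb(2)[OF inv])
  qed (use up in simp)
  show "AE x in \<rho>. x \<in> optima" if up: "(SUP \<theta>\<in>fc_thetas n. R_fc H n \<rho> \<theta>) \<le> ereal (value_fc n)"
    using R_fc_lower[OF n]
  proof (elim disjE conjE)
    assume inv: "invertible (Sigma_mat \<rho>)"
      and le: "ereal ((1 / real n) * (moment 0 - (1 - 1 / real CARD('d)))) \<le> (SUP \<theta>\<in>fc_thetas n. R_fc H n \<rho> \<theta>)"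
    have "(1 / real n) * (moment 0 - (1 - 1 / real CARD('d))) \<le> value_fc n"
      using order_trans[OF le up] by simp
    then have "moment 0 \<le> (real CARD('k))\<^sup>2 / T_star CARD('d) lam"
      unfolding value_fc_def mult_le_cancel_left_pos[OF n0] by simp
    then show ?thesis by (rule mb(2)[OF inv])
  qed (use up in simp)
qed

text \<open>The moment is constant on optimal laws. In the i.i.d. design the subtracted squared norm
  of \<open>hvec\<close> can only lower the risk; under a fixed composition the risk does not depend
  on \<theta>.\<close>

lemma value_upper:
  assumes opt: "optimal_law \<rho>" and n: "n \<ge> 1"
  shows "(SUP \<theta>\<in>prob_simplex. R_iid H n \<rho> \<theta>) \<le> ereal (value_iid n)"
    and "(SUP \<theta>\<in>fc_thetas n. R_fc H n \<rho> \<theta>) \<le> ereal (value_fc n)"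
proof -
  interpret anchored_law H \<rho> by (rule optimal_law_anchored) fact
  note inv = optimal_law_invertible[OF opt] and m = optimal_law_moment[OF opt]
  show "(SUP \<theta>\<in>prob_simplex. R_iid H n \<rho> \<theta>) \<le> ereal (value_iid n)"
  proof (rule SUP_least)
    fix \<theta> :: "real^'d" assume \<theta>: "\<theta> \<in> prob_simplex"
    show "R_iid H n \<rho> \<theta> \<le> ereal (value_iid n)"
      unfolding R_iid_eq[OF inv n \<theta>] m value_iid_def ereal_less_eq(3) by (intro mult_left_mono) auto
  qed
  show "(SUP \<theta>\<in>fc_thetas n. R_fc H n \<rho> \<theta>) \<le> ereal (value_fc n)"
    by (rule SUP_least) (simp add: R_fc_eq[OF inv n] m value_fc_def)
qed

lemma exists_optimal_law: "\<exists>\<rho>. optimal_law \<rho>"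
  using S_star_nonempty[OF d2, of lam] convcomb_opt_rho_s convcomb_opt_iff by blast

lemma minimax_value:
  assumes \<epsilon>: "lam = exp \<epsilon>" and n: "n \<ge> 1"
  shows "(INF \<rho>\<in>feasible H \<epsilon>. SUP \<theta>\<in>prob_simplex. R_iid H n \<rho> \<theta>) = ereal (value_iid n)"
    and "(INF \<rho>\<in>feasible H \<epsilon>. SUP \<theta>\<in>fc_thetas n. R_fc H n \<rho> \<theta>) = ereal (value_fc n)"
proof -
  obtain \<rho> where \<rho>: "optimal_law \<rho>" using exists_optimal_law ..
  note f = optimal_law_feasible[OF \<rho> \<epsilon>]
  show "(INF \<rho>\<in>feasible H \<epsilon>. SUP \<theta>\<in>prob_simplex. R_iid H n \<rho> \<theta>) = ereal (value_iid n)"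
  proof (rule antisym)
    show "(INF \<rho>\<in>feasible H \<epsilon>. SUP \<theta>\<in>prob_simplex. R_iid H n \<rho> \<theta>) \<le> ereal (value_iid n)"
      using INF_lower[OF f] value_upper(1)[OF \<rho> n] by (rule order_trans)
    show "ereal (value_iid n) \<le> (INF \<rho>\<in>feasible H \<epsilon>. SUP \<theta>\<in>prob_simplex. R_iid H n \<rho> \<theta>)"
      by (rule INF_greatest) (rule value_lower(1)[OF _ \<epsilon> n])
  qed
  show "(INF \<rho>\<in>feasible H \<epsilon>. SUP \<theta>\<in>fc_thetas n. R_fc H n \<rho> \<theta>) = ereal (value_fc n)"
  proof (rule antisym)
    show "(INF \<rho>\<in>feasible H \<epsilon>. SUP \<theta>\<in>fc_thetas n. R_fc H n \<rho> \<theta>) \<le> ereal (value_fc n)"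
      using INF_lower[OF f] value_upper(2)[OF \<rho> n] by (rule order_trans)
    show "ereal (value_fc n) \<le> (INF \<rho>\<in>feasible H \<epsilon>. SUP \<theta>\<in>fc_thetas n. R_fc H n \<rho> \<theta>)"
      by (rule INF_greatest) (rule value_lower(2)[OF _ \<epsilon> n])
  qed
qed

text \<open>As equivalences these identify both sets of exchangeable minimizers with the set of
  convex combinations, so that \<open>extreme_convcomb\<close> settles the extreme points for both
  designs.\<close>

lemma exchangeable_minimizer_iff:
  assumes \<epsilon>: "lam = exp \<epsilon>" and n: "n \<ge> 1"
  shows "exchangeable H \<rho> \<and> minimizer_iid H n \<epsilon> \<rho> \<longleftrightarrow> convcomb_opt H lam \<rho>"
    and "exchangeable H \<rho> \<and> minimizer_fc H n \<epsilon> \<rho> \<longleftrightarrow> convcomb_opt H lam \<rho>"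
proof -
  have law: "optimal_law \<rho>"
    if "\<rho> \<in> feasible H \<epsilon>" "exchangeable H \<rho>" "AE x in \<rho>. x \<in> optima"
    using that by (simp add: optimal_law_def feasible_def anchored_def)
  have ex: "exchangeable H \<rho>" if "optimal_law \<rho>" using that by (simp add: optimal_law_def)
  show "exchangeable H \<rho> \<and> minimizer_iid H n \<epsilon> \<rho> \<longleftrightarrow> convcomb_opt H lam \<rho>"
    unfolding convcomb_opt_iff minimizer_iid_def minimax_value[OF \<epsilon> n]
    using law ex value_lower(1,3)[OF _ \<epsilon> n, of \<rho>] value_upper(1)[OF _ n] optimal_law_feasible[OF _ \<epsilon>]
    by (metis antisym order_refl)
  show "exchangeable H \<rho> \<and> minimizer_fc H n \<epsilon> \<rho> \<longleftrightarrow> convcomb_opt H lam \<rho>"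
    unfolding convcomb_opt_iff minimizer_fc_def minimax_value[OF \<epsilon> n]
    using law ex value_lower(2,4)[OF _ \<epsilon> n, of \<rho>] value_upper(2)[OF _ n] optimal_law_feasible[OF _ \<epsilon>]
    by (metis antisym order_refl)
qed

end

theorem theorem9p4:
  fixes H :: "real^'k^'d" and n :: nat and \<epsilon>0 lam :: real
  assumes "valid_H H" and "CARD('d) \<ge> 2" and "n \<ge> 1" and "\<epsilon>0 > 0" and "lam = exp \<epsilon>0"
  shows "(INF \<rho>\<in>feasible H \<epsilon>0. SUP \<theta>\<in>prob_simplex. R_iid H n \<rho> \<theta>)
           = ereal ((real CARD('d) - 1)\<^sup>2 / (real n * T_star CARD('d) lam))
    \<and> (INF \<rho>\<in>feasible H \<epsilon>0. SUP \<theta>\<in>fc_thetas n. R_fc H n \<rho> \<theta>)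
           = ereal ((1 / real n) * ((real CARD('d) - 1)\<^sup>2 / T_star CARD('d) lam
                                     - (real CARD('d) - 1) / real CARD('d)))
    \<and> (\<forall>\<rho>. convcomb_opt H lam \<rho> \<longrightarrow> minimizer_iid H n \<epsilon>0 \<rho> \<and> minimizer_fc H n \<epsilon>0 \<rho>)
    \<and> (\<forall>\<rho>. exchangeable H \<rho> \<and> (minimizer_iid H n \<epsilon>0 \<rho> \<or> minimizer_fc H n \<epsilon>0 \<rho>)
              \<longrightarrow> convcomb_opt H lam \<rho>)
    \<and> {\<rho>. extreme_in {\<rho>'. exchangeable H \<rho>' \<and> minimizer_iid H n \<epsilon>0 \<rho>'} \<rho>}
           = rho_s H lam ` S_star CARD('d) lam
    \<and> {\<rho>. extreme_in {\<rho>'. exchangeable H \<rho>' \<and> minimizer_fc H n \<epsilon>0 \<rho>'} \<rho>}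
           = rho_s H lam ` S_star CARD('d) lam"
proof -
  interpret optimal_frame H lam by standard (use assms in auto)
  note \<epsilon> = \<open>lam = exp \<epsilon>0\<close> and n = \<open>n \<ge> 1\<close>
  have v1: "value_iid n = (real CARD('d) - 1)\<^sup>2 / (real n * T_star CARD('d) lam)"
    by (simp add: value_iid_def card_k(1))
  have v2: "value_fc n = (1 / real n) * ((real CARD('d) - 1)\<^sup>2 / T_star CARD('d) lam
      - (real CARD('d) - 1) / real CARD('d))"
    by (simp add: value_fc_def card_k(1) diff_divide_distrib)
  note min = exchangeable_minimizer_iff[OF \<epsilon> n]
  have conv: "convcomb_opt H lam \<rho> \<longrightarrow> minimizer_iid H n \<epsilon>0 \<rho> \<and> minimizer_fc H n \<epsilon>0 \<rho>" for \<rho>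
    using min[of \<rho>] by blast
  have conv': "exchangeable H \<rho> \<and> (minimizer_iid H n \<epsilon>0 \<rho> \<or> minimizer_fc H n \<epsilon>0 \<rho>) \<longrightarrow> convcomb_opt H lam \<rho>" for \<rho>
    using min[of \<rho>] by blast
  show ?thesis
    unfolding minimax_value[OF \<epsilon> n] min extreme_convcomb v1 v2 by (intro conjI allI refl conv conv')
qed

end
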